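(* If the number $K$ of budget constraints in $\mathcal{U}^{\mathcal{HP}}_1$ is constant, then the robust two-stage \textsc{Representatives Selection} problem with uncertainty set $\mathcal{U}^{\mathcal{HP}}_1$ admits an FPTAS.
   Context: \textsc{Representatives Selection}: $[n]$ is partitioned into disjoint sets $T_1,\dots,T_\ell$ and $\mathcal{X}=\{\mathbf{x}\in\{0,1\}^n:\sum_{i\in T_l}x_i=1,\ l\in[\ell]\}$; first-stage costs $\mathbf{C}\in\mathbb{R}^n_{\ge0}$; $\mathcal{R}(\mathbf{x})=\{\mathbf{y}\in\{0,1\}^n:\mathbf{x}+\mathbf{y}\in\mathcal{X}\}$, $\mathcal{X}'=\{\mathbf{x}\in\{0,1\}^n:\mathcal{R}(\mathbf{x})\ne\emptyset\}$; the robust two-stage problem is $\min_{\mathbf{x}\in\mathcal{X}'}\max_{\mathbf{c}\in\mathcal{U}}\min_{\mathbf{y}\in\mathcal{R}(\mathbf{x})}(\mathbf{C}^T\mathbf{x}+\mathbf{c}^T\mathbf{y})$. Here $\mathcal{U}=\mathcal{U}^{\mathcal{HP}}_1=\{\underline{\mathbf{c}}+\boldsymbol{\delta}:\sum_{i\in U_j}\delta_i\le\Gamma_j,\ j\in[K],\ \boldsymbol{\delta}\ge\mathbf{0}\}$ with $\underline{\mathbf{c}}\ge\mathbf{0}$, subsets $U_1,\dots,U_K\subseteq[n]$ and $\Gamma_j\ge0$. An FPTAS returns, for every $\epsilon>0$, a solution of value at most $(1+\epsilon)$ times optimal in time polynomial in the input size and $1/\epsilon$. *)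

theory Defs
  imports
    "HOL-Library.Extended_Real"
    "HOL-Library.Disjoint_Sets"
    "HOL-Library.Log_Nat"
    "Jordan_Normal_Form.Matrix"
begin

section \<open>A model of computation\<close>

text \<open>
  Polynomial running time is measured for programs of a small first-order language, given by
  finite syntax, over binary trees whose leaves are integers in binary notation. Every evaluation
  step is charged the full bit size of the data it reads and every primitive operation also that of
  the data it writes, so that neither large integers nor copied trees come for free. Hence running
  times agree with those of multitape Turing machines up to a polynomial.
\<close>

datatype val = Num int | Pair val val

fun bitsize :: "val \<Rightarrow> nat" where
  "bitsize (Num z) = 1 + floorlog 2 (nat \<bar>z\<bar>)"
| "bitsize (Pair u v) = 1 + bitsize u + bitsize v"

datatype primop = Id | Const int | Fst | Snd | IsPair | Add | Sub | Mul | Div | Leq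

fun apply_op :: "primop \<Rightarrow> val \<Rightarrow> val option" where
  "apply_op Id v = Some v"
| "apply_op (Const k) v = Some (Num k)"
| "apply_op Fst (Pair u v) = Some u"
| "apply_op Snd (Pair u v) = Some v"
| "apply_op IsPair (Pair u v) = Some (Num 1)"
| "apply_op IsPair (Num a) = Some (Num 0)"
| "apply_op Add (Pair (Num a) (Num b)) = Some (Num (a + b))"
| "apply_op Sub (Pair (Num a) (Num b)) = Some (Num (a - b))"
| "apply_op Mul (Pair (Num a) (Num b)) = Some (Num (a * b))"
| "apply_op Div (Pair (Num a) (Num b)) = Some (Num (a div b))"
| "apply_op Leq (Pair (Num a) (Num b)) = Some (Num (if a \<le> b then 1 else 0))"
| "apply_op _ _ = None"

datatype prog =
    Prim primop
  | Both prog prog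
  | Seq prog prog
  | Cond prog prog prog
  | While prog prog

text \<open>
  \<open>runs p v w t\<close>: program \<open>p\<close> halts on input \<open>v\<close> with output \<open>w\<close> in time \<open>t\<close>.
  A test fails exactly if it returns \<open>Num 0\<close>.
\<close>

inductive runs :: "prog \<Rightarrow> val \<Rightarrow> val \<Rightarrow> nat \<Rightarrow> bool" where
  Prim: "apply_op f v = Some w \<Longrightarrow> runs (Prim f) v w (1 + bitsize v + bitsize w)"
| Both: "runs p v w s \<Longrightarrow> runs q v w' t \<Longrightarrow>
    runs (Both p q) v (Pair w w') (1 + bitsize v + s + t)"
| Seq: "runs p u v s \<Longrightarrow> runs q v w t \<Longrightarrow> runs (Seq p q) u w (1 + bitsize u + s + t)"
| Cond_True: "runs b v c s \<Longrightarrow> c \<noteq> Num 0 \<Longrightarrow> runs p v w t \<Longrightarrow>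
    runs (Cond b p q) v w (1 + bitsize v + s + t)"
| Cond_False: "runs b v (Num 0) s \<Longrightarrow> runs q v w t \<Longrightarrow>
    runs (Cond b p q) v w (1 + bitsize v + s + t)"
| While_True: "runs b u c r \<Longrightarrow> c \<noteq> Num 0 \<Longrightarrow> runs p u v s \<Longrightarrow> runs (While b p) v w t \<Longrightarrow>
    runs (While b p) u w (1 + bitsize u + r + s + t)"
| While_False: "runs b v (Num 0) s \<Longrightarrow> runs (While b p) v v (1 + bitsize v + s)"

fun enc_list :: "val list \<Rightarrow> val" where
  "enc_list [] = Num 0"
| "enc_list (v # vs) = Pair v (enc_list vs)"

definition enc_rat :: "rat \<Rightarrow> val" where
  "enc_rat r = (case quotient_of r of (a, b) \<Rightarrow> Pair (Num a) (Num b))"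

definition enc_rat_vec :: "rat vec \<Rightarrow> val" where
  "enc_rat_vec v = enc_list (map enc_rat (list_of_vec v))"

definition enc_set :: "nat set \<Rightarrow> val" where
  "enc_set A = enc_list (map (\<lambda>i. Num (int i)) (sorted_list_of_set A))"

section \<open>Fully polynomial-time approximation schemes\<close>

record ('i, 's) min_problem =
  valid_inputs :: "'i set"
  solutions :: "'i \<Rightarrow> 's set"
  objective :: "'i \<Rightarrow> 's \<Rightarrow> ereal"
  enc_input :: "'i \<Rightarrow> val"
  enc_solution :: "'s \<Rightarrow> val"

definition optimum :: "('i, 's) min_problem \<Rightarrow> 'i \<Rightarrow> ereal" where
  "optimum M I = (INF x\<in>solutions M I. objective M I x)"

text \<open>
  One program serves all inputs and all accuracies. It receives the instance together with a
  rational \<open>\<epsilon>\<close>, so the size of its input includes that of \<open>\<epsilon>\<close>. Calling it with \<open>1 / \<lceil>1/\<epsilon>\<rceil>\<close> instead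
  covers real \<open>\<epsilon>\<close> as well and gives a bound in the size of the instance and \<open>1/\<epsilon>\<close> alone.
\<close>

definition admits_FPTAS :: "('i, 's) min_problem \<Rightarrow> bool" where
  "admits_FPTAS M \<longleftrightarrow>
    (\<exists>(p :: prog) (d :: nat) (a :: nat \<Rightarrow> nat \<Rightarrow> real).
      \<forall>I \<in> valid_inputs M. \<forall>\<epsilon> :: rat. \<epsilon> > 0 \<longrightarrow>
        (let v = Pair (enc_input M I) (enc_rat \<epsilon>) in
          \<exists>x \<in> solutions M I. \<exists>t.
            runs p v (enc_solution M x) t \<and>
            objective M I x \<le> ereal (1 + of_rat \<epsilon>) * optimum M I \<and>
            real t \<le> (\<Sum>i\<le>d. \<Sum>j\<le>d. a i j * real (bitsize v) ^ i * (1 / of_rat \<epsilon>) ^ j)))"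

section \<open>Robust two-stage problems\<close>

definition binary_vecs :: "nat \<Rightarrow> real vec set" where
  "binary_vecs n = {x \<in> carrier_vec n. \<forall>i<n. x $ i \<in> {0, 1}}"

definition recourse :: "nat \<Rightarrow> real vec set \<Rightarrow> real vec \<Rightarrow> real vec set" where
  "recourse n X x = {y \<in> binary_vecs n. x + y \<in> X}"

definition first_stage :: "nat \<Rightarrow> real vec set \<Rightarrow> real vec set" where
  "first_stage n X = {x \<in> binary_vecs n. recourse n X x \<noteq> {}}"

text \<open>
  The maximum over the uncertainty set is taken as a supremum in the extended reals: \<open>U\<close> may be
  unbounded, and then the worst case of a first-stage solution may be infinite.
\<close>

definition two_stage_cost ::
  "nat \<Rightarrow> real vec set \<Rightarrow> real vec \<Rightarrow> real vec set \<Rightarrow> real vec \<Rightarrow> ereal" where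
  "two_stage_cost n X C U x = (SUP c\<in>U. INF y\<in>recourse n X x. ereal (C \<bullet> x + c \<bullet> y))"

text \<open>The index set \<open>[n]\<close> is \<open>{..<n}\<close>, as for the entries of vectors.\<close>

definition RS_set :: "nat \<Rightarrow> nat set list \<Rightarrow> real vec set" where
  "RS_set n Ts = {x \<in> binary_vecs n. \<forall>l<length Ts. (\<Sum>i\<in>Ts ! l. x $ i) = 1}"

definition U_HP1 :: "nat \<Rightarrow> real vec \<Rightarrow> nat set list \<Rightarrow> real vec \<Rightarrow> real vec set" where
  "U_HP1 n c\<^sub>0 Us \<Gamma> =
    {c\<^sub>0 + \<delta> | \<delta>. \<delta> \<in> carrier_vec n \<and> (\<forall>i<n. 0 \<le> \<delta> $ i) \<and>
      (\<forall>j<length Us. (\<Sum>i\<in>Us ! j. \<delta> $ i) \<le> \<Gamma> $ j)}"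

record RS_instance =
  dimen :: nat
  parts :: "nat set list"
  first_cost :: "rat vec"
  nominal_cost :: "rat vec"
  budget_sets :: "nat set list"
  budgets :: "rat vec"

definition RS_instances :: "nat \<Rightarrow> RS_instance set" where
  "RS_instances K = {I.
    partition_on {..<dimen I} (set (parts I)) \<and> distinct (parts I) \<and>
    first_cost I \<in> carrier_vec (dimen I) \<and> (\<forall>i<dimen I. 0 \<le> first_cost I $ i) \<and>
    nominal_cost I \<in> carrier_vec (dimen I) \<and> (\<forall>i<dimen I. 0 \<le> nominal_cost I $ i) \<and>
    length (budget_sets I) = K \<and> (\<forall>j<K. budget_sets I ! j \<subseteq> {..<dimen I}) \<and>
    budgets I \<in> carrier_vec K \<and> (\<forall>j<K. 0 \<le> budgets I $ j)}"

definition enc_RS_instance :: "RS_instance \<Rightarrow> val" where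
  "enc_RS_instance I = enc_list
    [Num (int (dimen I)), enc_list (map enc_set (parts I)),
     enc_rat_vec (first_cost I), enc_rat_vec (nominal_cost I),
     enc_list (map enc_set (budget_sets I)), enc_rat_vec (budgets I)]"

text \<open>The floor only converts the entries, which are 0 or 1, to integers.\<close>

definition enc_binary_vec :: "real vec \<Rightarrow> val" where
  "enc_binary_vec x = enc_list (map (\<lambda>r. Num \<lfloor>r\<rfloor>) (list_of_vec x))"

definition two_stage_RS_HP1 :: "nat \<Rightarrow> (RS_instance, real vec) min_problem" where
  "two_stage_RS_HP1 K =
    \<lparr>valid_inputs = RS_instances K,
     solutions = (\<lambda>I. first_stage (dimen I) (RS_set (dimen I) (parts I))),
     objective = (\<lambda>I. two_stage_cost (dimen I) (RS_set (dimen I) (parts I))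
       (map_vec of_rat (first_cost I))
       (U_HP1 (dimen I) (map_vec of_rat (nominal_cost I)) (budget_sets I)
         (map_vec of_rat (budgets I)))),
     enc_input = enc_RS_instance,
     enc_solution = enc_binary_vec\<rparr>"

end

theory Submission
  imports Defs
begin

text \<open>
  For multipliers \<open>\<lambda>\<close> of the budget constraints, linear programming duality turns the worst case of a
  set of open parts (those left to the second stage) into \<open>\<Sum>\<^sub>j \<Gamma>\<^sub>j \<lambda>\<^sub>j\<close> plus, for each open part, the
  maximum over \<open>t\<close> of \<open>t - \<Sum>\<^sub>i w\<^sub>i max 0 (t - c\<^sub>i)\<close>, where \<open>w\<^sub>i\<close> is the sum of the \<open>\<lambda>\<^sub>j\<close> with \<open>i \<in> U\<^sub>j\<close>.
  For fixed \<open>\<lambda>\<close> the parts are independent, and for each one it only remains to compare this maximum,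
  attained at some \<open>t = c\<^sub>i\<close>, with the cheapest first-stage cost. An optimal \<open>\<lambda>\<close> exists in \<open>[0, 1]\<^sup>K\<close>.
  Replacing \<open>\<lambda>\<^sub>j\<close> by \<open>\<lfloor>N \<lambda>\<^sub>j\<rfloor> / M\<close> with \<open>N = M + n (K + 1)\<close> keeps it feasible, since rounding loses at
  most \<open>n K\<close> in each sum of the \<open>w\<^sub>i\<close> scaled by \<open>N\<close>, and costs only the factor \<open>N / M\<close>, which is at
  most \<open>1 + \<epsilon>\<close> if \<open>M\<close> is about \<open>n (K + 1) / \<epsilon>\<close>. So it suffices to search the grid \<open>{0, \<dots>, N}\<^sup>K\<close>.
\<close>

section \<open>Encodings of typed data\<close>

text \<open>That optimal multipliers can be taken in the unit cube is what makes a finite grid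
  possible. The reason is exact penalisation: shrinking a deviation on \<open>U j\<close> until its
  budget holds lowers the sum of the part minima by at most the amount removed, so a price of 1 per
  unit of violation already suffices. The same estimate takes the place of a constraint
  qualification, so budgets of 0 cause no trouble. Infinite worst cases show up in the dual as parts
  whose weights sum to less than 1 (less than \<open>M\<close> after scaling); such a part has to be
  closed. The grid has \<open>N + 1\<close> values per multiplier, and \<open>N\<close> is
  polynomial in the size of the instance and 1/eps, but not in the number of digits of eps. Hence
  the list \<open>[0..N]\<close> is produced by a separate counting program, and the rest is shown
  to run in polynomial time with this list as part of its input. Rounding needs only
  \<open>N - M >= n K\<close>; the further summand \<open>n\<close> ensures \<open>N >= n\<close>
  also for \<open>K = 0\<close>, so that the same list supplies the indices of the vectors.\<close>

class encodable =
  fixes encode :: "'a \<Rightarrow> val"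

instantiation int :: encodable
begin
definition "encode (k :: int) = Num k"
instance ..
end

instantiation bool :: encodable
begin
definition "encode b = Num (if b then 1 else 0)"
instance ..
end

instantiation prod :: (encodable, encodable) encodable
begin
definition "encode p = Pair (encode (fst p)) (encode (snd p))"
instance ..
end

instantiation list :: (encodable) encodable
begin
definition "encode xs = enc_list (map encode xs)"
instance ..
end

abbreviation esize :: "'a::encodable \<Rightarrow> nat" where
  "esize x \<equiv> bitsize (encode x)"

lemma bitsize_pos: "1 \<le> bitsize v"
  by (cases v) auto

lemma esize_pos: "1 \<le> esize x"
  by (rule bitsize_pos)

text \<open>Nonempty lists and pairs share one representation, so building a list cell or splitting
  it into head and tail is just pairing and projecting. \<open>ptime_Cons\<close> and the loop body
  of \<open>ptime_foldl\<close> rely on this.\<close>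

lemma encode_Cons: "encode (x # xs) = encode (x, xs)"
  by (simp add: encode_list_def encode_prod_def)

lemma esize_prod [simp]: "esize (x, y) = 1 + esize x + esize y"
  by (simp add: encode_prod_def)

lemma esize_Cons [simp]: "esize (x # xs) = 1 + esize x + esize xs"
  by (simp add: encode_Cons)

lemma esize_Nil: "esize [] = 1"
  by (simp add: encode_list_def floorlog_def)

lemma length_le_esize: "length xs \<le> esize xs"
  by (induction xs) auto

lemma esize_mem: "x \<in> set xs \<Longrightarrow> esize x \<le> esize xs"
  by (induction xs) auto

section \<open>Polynomially bounded functions\<close>

text \<open>One monomial is as good as a polynomial because \<open>esize\<close> is at least 1.
  Unlike \<open>g\<close> it is monotone in the size, so bounds on sizes can be substituted into
  it.\<close>

definition poly_bounded :: "('a::encodable \<Rightarrow> nat) \<Rightarrow> bool" where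
  "poly_bounded g \<longleftrightarrow> (\<exists>c d. \<forall>x. g x \<le> c * esize x ^ d)"

lemma poly_boundedI: "(\<And>x. g x \<le> c * esize x ^ d) \<Longrightarrow> poly_bounded g"
  unfolding poly_bounded_def by blast

lemma poly_bounded_mono: "poly_bounded h \<Longrightarrow> (\<And>x. g x \<le> h x) \<Longrightarrow> poly_bounded g"
  unfolding poly_bounded_def by (meson le_trans)

lemma poly_bounded_const: "poly_bounded (\<lambda>_. k)"
  by (rule poly_boundedI[where c = k and d = 0]) simp

lemma poly_bounded_esize: "poly_bounded esize"
  by (rule poly_boundedI[where c = 1 and d = 1]) simp

lemma poly_bounded_add:
  assumes "poly_bounded g" "poly_bounded h"
  shows "poly_bounded (\<lambda>x. g x + h x)"
proof -
  obtain c d c' d' where gh: "\<And>x. g x \<le> c * esize x ^ d" "\<And>x. h x \<le> c' * esize x ^ d'"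
    using assms unfolding poly_bounded_def by blast
  have "g x + h x \<le> (c + c') * esize x ^ max d d'" for x
  proof -
    have "esize x ^ d \<le> esize x ^ max d d'" "esize x ^ d' \<le> esize x ^ max d d'"
      by (intro power_increasing esize_pos, simp)+
    then show ?thesis using gh[of x]
      by (smt (verit) add_mono add_mult_distrib le_trans mult_le_mono2)
  qed
  then show ?thesis by (rule poly_boundedI)
qed

lemma poly_bounded_mult:
  assumes "poly_bounded g" "poly_bounded h"
  shows "poly_bounded (\<lambda>x. g x * h x)"
proof -
  obtain c d c' d' where gh: "\<And>x. g x \<le> c * esize x ^ d" "\<And>x. h x \<le> c' * esize x ^ d'"
    using assms unfolding poly_bounded_def by blast
  have "g x * h x \<le> (c * c') * esize x ^ (d + d')" for x
    using mult_mono[OF gh(1)[of x] gh(2)[of x]] by (simp add: power_add algebra_simps)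
  then show ?thesis by (rule poly_boundedI)
qed

lemma poly_bounded_power: "poly_bounded g \<Longrightarrow> poly_bounded (\<lambda>x. g x ^ d)"
  by (induction d) (simp_all add: poly_bounded_const poly_bounded_mult)

lemma poly_bounded_Suc: "poly_bounded g \<Longrightarrow> poly_bounded (\<lambda>x. Suc (g x))"
  using poly_bounded_add[OF _ poly_bounded_const[of 1]] by simp

lemmas poly_bounded_intros =
  poly_bounded_const poly_bounded_esize poly_bounded_Suc poly_bounded_add poly_bounded_mult poly_bounded_power

lemma poly_bounded_comp:
  assumes "poly_bounded g" "poly_bounded (\<lambda>x. esize (f x))"
  shows "poly_bounded (\<lambda>x. g (f x))"
proof -
  obtain c d where g: "\<And>x. g x \<le> c * esize x ^ d"
    using assms unfolding poly_bounded_def by blast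
  have "poly_bounded (\<lambda>x. c * esize (f x) ^ d)"
    by (intro poly_bounded_intros assms)
  then show ?thesis by (rule poly_bounded_mono) (rule g)
qed

section \<open>Polynomial-time functions\<close>

text \<open>Only inputs of the form \<open>encode x\<close> matter, so a program may rely on the
  type of its data and never has to check it.\<close>

definition ptime :: "('a::encodable \<Rightarrow> 'b::encodable) \<Rightarrow> bool" where
  "ptime f \<longleftrightarrow> (\<exists>p T. poly_bounded T \<and> (\<forall>x. \<exists>t\<le>T x. runs p (encode x) (encode (f x)) t))"

lemma ptimeE:
  assumes "ptime f"
  obtains p T where "poly_bounded T" "\<And>x. \<exists>t\<le>T x. runs p (encode x) (encode (f x)) t"
  using assms unfolding ptime_def by blast

lemma ptimeI:
  "poly_bounded T \<Longrightarrow> (\<And>x. \<exists>t\<le>T x. runs p (encode x) (encode (f x)) t) \<Longrightarrow> ptime f"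
  unfolding ptime_def by blast

text \<open>Primitive operations are charged for their output, a finished loop for its final state,
  and \<open>Both\<close> adds the times of its components, so time always covers what is
  written.\<close>

lemma bitsize_le_time: "runs p v w t \<Longrightarrow> bitsize w \<le> t"
  by (induction rule: runs.induct) auto

text \<open>This is what makes composition polynomial: the second program runs on an input no larger
  than the running time of the first.\<close>

lemma ptime_esize:
  assumes "ptime f"
  shows "poly_bounded (\<lambda>x. esize (f x))"
proof -
  obtain p T where p: "poly_bounded T" "\<And>x. \<exists>t\<le>T x. runs p (encode x) (encode (f x)) t"
    using assms by (rule ptimeE) blast
  have "esize (f x) \<le> T x" for x
    using p(2)[of x] bitsize_le_time le_trans by blast
  then show ?thesis by (rule poly_bounded_mono[OF p(1)])
qed

lemma ptime_comp:
  assumes "ptime f" "ptime g"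
  shows "ptime (\<lambda>x. f (g x))"
proof -
  obtain p S where p: "poly_bounded S" "\<And>x. \<exists>t\<le>S x. runs p (encode x) (encode (f x)) t"
    using assms(1) by (rule ptimeE) blast
  obtain q T where q: "poly_bounded T" "\<And>x. \<exists>t\<le>T x. runs q (encode x) (encode (g x)) t"
    using assms(2) by (rule ptimeE) blast
  have "\<exists>t\<le>1 + esize x + T x + S (g x). runs (Seq q p) (encode x) (encode (f (g x))) t" for x
  proof -
    obtain s t where "s \<le> T x" "runs q (encode x) (encode (g x)) s"
      "t \<le> S (g x)" "runs p (encode (g x)) (encode (f (g x))) t"
      using p(2) q(2) by meson
    then show ?thesis by (intro exI[of _ "1 + esize x + s + t"] conjI runs.Seq) auto
  qed
  moreover have "poly_bounded (\<lambda>x. 1 + esize x + T x + S (g x))"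
    by (intro poly_bounded_intros q(1) poly_bounded_comp[OF p(1)] ptime_esize assms)
  ultimately show ?thesis by (intro ptimeI)
qed

lemma ptime_Pair:
  assumes "ptime f" "ptime g"
  shows "ptime (\<lambda>x. (f x, g x))"
proof -
  obtain p S where p: "poly_bounded S" "\<And>x. \<exists>t\<le>S x. runs p (encode x) (encode (f x)) t"
    using assms(1) by (rule ptimeE) blast
  obtain q T where q: "poly_bounded T" "\<And>x. \<exists>t\<le>T x. runs q (encode x) (encode (g x)) t"
    using assms(2) by (rule ptimeE) blast
  have "\<exists>t\<le>1 + esize x + S x + T x. runs (Both p q) (encode x) (encode (f x, g x)) t" for x
  proof -
    obtain s t where "s \<le> S x" "runs p (encode x) (encode (f x)) s"
      "t \<le> T x" "runs q (encode x) (encode (g x)) t"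
      using p(2) q(2) by meson
    then show ?thesis
      by (intro exI[of _ "1 + esize x + s + t"])
        (simp add: encode_prod_def runs.Both[unfolded One_nat_def, simplified])
  qed
  moreover have "poly_bounded (\<lambda>x. 1 + esize x + S x + T x)"
    by (intro poly_bounded_intros q(1) p(1))
  ultimately show ?thesis by (intro ptimeI)
qed

lemma ptime_if:
  assumes "ptime b" "ptime f" "ptime g"
  shows "ptime (\<lambda>x. if b x then f x else g x)"
proof -
  obtain r R where r: "poly_bounded R" "\<And>x. \<exists>t\<le>R x. runs r (encode x) (encode (b x)) t"
    using assms(1) by (rule ptimeE) blast
  obtain p S where p: "poly_bounded S" "\<And>x. \<exists>t\<le>S x. runs p (encode x) (encode (f x)) t"
    using assms(2) by (rule ptimeE) blast
  obtain q T where q: "poly_bounded T" "\<And>x. \<exists>t\<le>T x. runs q (encode x) (encode (g x)) t"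
    using assms(3) by (rule ptimeE) blast
  have "\<exists>t\<le>1 + esize x + R x + S x + T x.
      runs (Cond r p q) (encode x) (encode (if b x then f x else g x)) t" for x
  proof -
    obtain u where u: "u \<le> R x" "runs r (encode x) (encode (b x)) u" using r(2) by meson
    obtain s where s: "s \<le> S x" "runs p (encode x) (encode (f x)) s" using p(2) by meson
    obtain t where t: "t \<le> T x" "runs q (encode x) (encode (g x)) t" using q(2) by meson
    show ?thesis
    proof (cases "b x")
      case True
      then have "runs (Cond r p q) (encode x) (encode (f x)) (1 + esize x + u + s)"
        using u s by (intro runs.Cond_True) (auto simp: encode_bool_def)
      then show ?thesis using True u s by (intro exI[of _ "1 + esize x + u + s"]) auto
    next
      case False
      then have "runs (Cond r p q) (encode x) (encode (g x)) (1 + esize x + u + t)"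
        using u t by (intro runs.Cond_False) (auto simp: encode_bool_def)
      then show ?thesis using False u t by (intro exI[of _ "1 + esize x + u + t"]) auto
    qed
  qed
  moreover have "poly_bounded (\<lambda>x. 1 + esize x + R x + S x + T x)"
    by (intro poly_bounded_intros r(1) q(1) p(1))
  ultimately show ?thesis by (intro ptimeI)
qed

lemma ptime_Prim:
  assumes "\<And>x. apply_op f (encode x) = Some (encode (g x))"
    and "poly_bounded (\<lambda>x. esize (g x))"
  shows "ptime g"
proof (rule ptimeI)
  show "poly_bounded (\<lambda>x. 1 + esize x + esize (g x))"
    by (intro poly_bounded_intros assms)
  show "\<exists>t\<le>1 + esize x + esize (g x). runs (Prim f) (encode x) (encode (g x)) t" for x
    using runs.Prim[OF assms(1)] by blast
qed

text \<open>Only integers are primitive constants, so the program is assembled along the tree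
  \<open>encode c\<close>. Each of its nodes reads the input, hence a time linear in
  \<open>esize x\<close>.\<close>

lemma ptime_const:
  fixes c :: "'a::encodable"
  shows "ptime (\<lambda>_ :: 'b::encodable. c)"
proof -
  have "\<exists>p k. \<forall>x::'b. \<exists>t\<le>k * esize x. runs p (encode x) v t" for v
  proof (induction v)
    case (Num z)
    have "\<exists>t\<le>(2 + bitsize (Num z)) * esize x. runs (Prim (Const z)) (encode x) (Num z) t"
      for x :: 'b
    proof (intro exI conjI)
      show "runs (Prim (Const z)) (encode x) (Num z) (1 + esize x + bitsize (Num z))"
        by (intro runs.Prim) simp
      have "(1 + bitsize (Num z)) * 1 \<le> (1 + bitsize (Num z)) * esize x"
        by (intro mult_le_mono2 esize_pos)
      then show "1 + esize x + bitsize (Num z) \<le> (2 + bitsize (Num z)) * esize x"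
        by (simp add: algebra_simps)
    qed
    then show ?case by blast
  next
    case (Pair u v)
    then obtain p k q l where *: "\<And>x::'b. \<exists>t\<le>k * esize x. runs p (encode x) u t"
      "\<And>x::'b. \<exists>t\<le>l * esize x. runs q (encode x) v t"
      by blast
    have "\<exists>t\<le>(2 + k + l) * esize x. runs (Both p q) (encode x) (Pair u v) t" for x :: 'b
    proof -
      obtain s t where st: "s \<le> k * esize x" "runs p (encode x) u s" "t \<le> l * esize x"
        "runs q (encode x) v t" using * by meson
      show ?thesis using runs.Both[OF st(2,4)] st esize_pos[of x]
        by (intro exI[of _ "1 + esize x + s + t"]) (auto simp: algebra_simps)
    qed
    then show ?case by blast
  qed
  then obtain p k where "\<forall>x::'b. \<exists>t\<le>k * esize x. runs p (encode x) (encode c) t" by blast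
  moreover have "poly_bounded (\<lambda>x::'b. k * esize x)" by (intro poly_bounded_intros)
  ultimately show ?thesis by (intro ptimeI) auto
qed

lemma ptime_id: "ptime (\<lambda>x. x)"
  by (rule ptime_Prim[where f = Id]) (auto intro: poly_bounded_esize)

lemma ptime_fst': "ptime fst"
  by (rule ptime_Prim[where f = Fst], simp add: encode_prod_def)
    (rule poly_bounded_mono[OF poly_bounded_esize], auto simp: encode_prod_def)

lemma ptime_snd': "ptime snd"
  by (rule ptime_Prim[where f = Snd], simp add: encode_prod_def)
    (rule poly_bounded_mono[OF poly_bounded_esize], auto simp: encode_prod_def)

lemmas ptime_fst = ptime_comp[OF ptime_fst']
lemmas ptime_snd = ptime_comp[OF ptime_snd']

section \<open>Bit sizes of integers and the arithmetic primitives\<close>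

lemma esize_int: "esize (z :: int) = 1 + floorlog 2 (nat \<bar>z\<bar>)"
  by (simp add: encode_int_def)

lemma esize_int_le: "\<bar>z :: int\<bar> < 2 ^ k \<Longrightarrow> esize z \<le> 1 + k"
proof -
  assume "\<bar>z\<bar> < 2 ^ k"
  then have "nat \<bar>z\<bar> < 2 ^ k" by (simp add: nat_less_iff)
  then show ?thesis by (simp add: esize_int floorlog_leI)
qed

text \<open>The subtracted 1 is the charge of \<open>bitsize\<close> for the leaf itself; the rest
  is the number of binary digits.\<close>

lemma abs_less_two_power_esize: "\<bar>z :: int\<bar> < 2 ^ (esize z - 1)"
proof -
  have "nat \<bar>z\<bar> < 2 ^ floorlog 2 (nat \<bar>z\<bar>)"
    using floorlog_bounds[of "nat \<bar>z\<bar>" 2] by (cases "z = 0") auto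
  then show ?thesis by (simp add: esize_int nat_less_iff)
qed

lemma esize_int_add: "esize (y + z :: int) \<le> esize y + esize z"
proof -
  let ?y = "esize y - 1" and ?z = "esize z - 1"
  have "\<bar>y + z\<bar> < 2 ^ ?y + (2::int) ^ ?z"
    using abs_less_two_power_esize[of y] abs_less_two_power_esize[of z] by linarith
  also have "\<dots> \<le> 2 ^ (?y + ?z) + 2 ^ (?y + ?z)"
    by (intro add_mono power_increasing) auto
  also have "\<dots> = 2 ^ (?y + ?z + 1)" by simp
  finally have "esize (y + z) \<le> 1 + (?y + ?z + 1)" by (rule esize_int_le)
  then show ?thesis using esize_pos[of y] esize_pos[of z] by linarith
qed

lemma esize_int_uminus [simp]: "esize (- z :: int) = esize z"
  by (simp add: esize_int)

lemma esize_int_diff: "esize (y - z :: int) \<le> esize y + esize z"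
  using esize_int_add[of y "- z"] by simp

lemma esize_int_mult: "esize (y * z :: int) \<le> esize y + esize z"
proof -
  let ?y = "esize y - 1" and ?z = "esize z - 1"
  have "\<bar>y * z\<bar> < 2 ^ ?y * (2::int) ^ ?z"
    unfolding abs_mult
    using abs_less_two_power_esize[of y] abs_less_two_power_esize[of z]
    by (intro mult_strict_mono') auto
  then have "esize (y * z) \<le> 1 + (?y + ?z)"
    by (intro esize_int_le) (simp add: power_add)
  then show ?thesis using esize_pos[of y] esize_pos[of z] by linarith
qed

lemma esize_int_div: "esize (y div z :: int) \<le> 1 + esize y"
proof (rule order_trans[OF esize_int_le])
  have pos: "\<bar>a div b\<bar> \<le> \<bar>a\<bar>" if "b > 0" for a b :: int
  proof (cases "a \<ge> 0")
    case True
    then show ?thesis using that zdiv_mono2[of a 1 b] by (simp add: pos_imp_zdiv_nonneg_iff)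
  next
    case False
    then show ?thesis using that zdiv_mono2_neg[of a 1 b] div_neg_pos_less0[of a b] by simp
  qed
  \<comment> \<open>Division by 0 yields 0, and a negative divisor becomes positive through
    \<open>(- y) div (- z) = y div z\<close>.\<close>
  have "\<bar>y div z\<bar> \<le> \<bar>y\<bar>"
    using pos[of z y] pos[of "- z" "- y"] by (cases "z = 0"; cases "z > 0") auto
  then show "\<bar>y div z\<bar> < 2 ^ (esize y - 1)"
    using abs_less_two_power_esize[of y] by linarith
qed simp


lemma poly_bounded_intop:
  fixes f :: "int \<times> int \<Rightarrow> int"
  assumes "\<And>y z. esize (f (y, z)) \<le> 1 + esize y + esize z"
  shows "poly_bounded (\<lambda>x. esize (f x))"
  by (rule poly_bounded_mono[OF poly_bounded_esize]) (use assms in \<open>auto simp: encode_prod_def\<close>)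

lemma ptime_intop:
  fixes f :: "int \<Rightarrow> int \<Rightarrow> int"
  assumes "\<And>y z. apply_op opr (Pair (Num y) (Num z)) = Some (Num (f y z))"
    and "\<And>y z. esize (f y z) \<le> 1 + esize y + esize z"
    and "ptime g" "ptime h"
  shows "ptime (\<lambda>x. f (g x) (h x))"
proof -
  have "ptime (\<lambda>p. f (fst p) (snd p))"
    by (rule ptime_Prim[where f = opr], simp add: encode_prod_def encode_int_def assms)
      (rule poly_bounded_intop, simp add: assms[simplified])
  from ptime_comp[OF this ptime_Pair[OF assms(3,4)]] show ?thesis by simp
qed

lemma ptime_add: "ptime g \<Longrightarrow> ptime h \<Longrightarrow> ptime (\<lambda>x. g x + h x :: int)"
  by (rule ptime_intop[where opr = Add and f = "(+)"])
    (simp_all add: esize_int_add le_SucI)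

lemma ptime_diff: "ptime g \<Longrightarrow> ptime h \<Longrightarrow> ptime (\<lambda>x. g x - h x :: int)"
  by (rule ptime_intop[where opr = Sub and f = "(-)"])
    (simp_all add: esize_int_diff le_SucI)

lemma ptime_mult: "ptime g \<Longrightarrow> ptime h \<Longrightarrow> ptime (\<lambda>x. g x * h x :: int)"
  by (rule ptime_intop[where opr = Mul and f = "(*)"])
    (simp_all add: esize_int_mult le_SucI)

lemma ptime_div: "ptime g \<Longrightarrow> ptime h \<Longrightarrow> ptime (\<lambda>x. g x div h x :: int)"
  by (rule ptime_intop[where opr = Div and f = "(div)"])
    (simp_all add: le_trans[OF esize_int_div])

lemma esize_bool: "esize (b :: bool) \<le> 2"
  by (simp add: encode_bool_def floorlog_def)

lemma poly_bounded_esize_bool: "poly_bounded (\<lambda>x. esize (b x :: bool))"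
  by (rule poly_bounded_mono[OF poly_bounded_const]) (rule esize_bool)

lemma ptime_le:
  fixes g h :: "'a::encodable \<Rightarrow> int"
  assumes "ptime g" "ptime h"
  shows "ptime (\<lambda>x. g x \<le> h x)"
proof -
  have "ptime (\<lambda>p :: int \<times> int. fst p \<le> snd p)"
    by (rule ptime_Prim[where f = Leq, OF _ poly_bounded_esize_bool])
      (simp add: encode_prod_def encode_int_def encode_bool_def)
  from ptime_comp[OF this ptime_Pair[OF assms]] show ?thesis by simp
qed

lemma ptime_conj: "ptime b \<Longrightarrow> ptime c \<Longrightarrow> ptime (\<lambda>x. b x \<and> c x)"
  using ptime_if[of b c "\<lambda>_. False", OF _ _ ptime_const]
  by (rule back_subst[of ptime]) (auto split: if_splits)

lemma ptime_disj: "ptime b \<Longrightarrow> ptime c \<Longrightarrow> ptime (\<lambda>x. b x \<or> c x)"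
  using ptime_if[of b "\<lambda>_. True" c, OF _ ptime_const]
  by (rule back_subst[of ptime]) (auto split: if_splits)

lemma ptime_not: "ptime b \<Longrightarrow> ptime (\<lambda>x. \<not> b x)"
  using ptime_if[of b "\<lambda>_. False" "\<lambda>_. True", OF _ ptime_const ptime_const]
  by (rule back_subst[of ptime]) (auto split: if_splits)

lemma ptime_eq:
  "ptime g \<Longrightarrow> ptime h \<Longrightarrow> ptime (\<lambda>x. g x = (h x :: int))"
  unfolding eq_iff by (intro ptime_conj ptime_le)

lemma ptime_less:
  "ptime g \<Longrightarrow> ptime h \<Longrightarrow> ptime (\<lambda>x. g x < (h x :: int))"
  unfolding not_le[symmetric] by (intro ptime_not ptime_le)

lemma ptime_Cons:
  assumes "ptime g" "ptime h"
  shows "ptime (\<lambda>x. g x # h x)"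
  using ptime_Pair[OF assms] by (simp add: ptime_def encode_Cons)

lemma ptime_not_Nil: "ptime (\<lambda>xs. xs \<noteq> [])"
proof (rule ptime_Prim[where f = IsPair])
  show "apply_op IsPair (encode xs) = Some (encode (xs \<noteq> []))" for xs :: "'a list"
    by (cases xs) (simp_all add: encode_list_def encode_bool_def)
qed (rule poly_bounded_esize_bool)

section \<open>Loops\<close>

text \<open>\<open>body\<close> is required only where the test holds, since a loop body may take
  apart a list that is empty at the end. \<open>B\<close> also covers the state after the last
  iteration, where the test is evaluated once more; hence the factor \<open>n + 1\<close>.\<close>

lemma runs_While:
  fixes f :: "'s::encodable \<Rightarrow> 's" and b :: "'s \<Rightarrow> bool"
  assumes test: "\<And>s. \<exists>t\<le>T s. runs q (encode s) (encode (b s)) t"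
    and body: "\<And>s. b s \<Longrightarrow> \<exists>t\<le>T' s. runs p (encode s) (encode (f s)) t"
    and cond: "\<And>i. i < n \<Longrightarrow> b ((f ^^ i) s)" "\<not> b ((f ^^ n) s)"
    and bound: "\<And>i. i \<le> n \<Longrightarrow> 1 + esize ((f ^^ i) s) + T ((f ^^ i) s) + T' ((f ^^ i) s) \<le> B"
  shows "\<exists>t\<le>(n + 1) * B. runs (While q p) (encode s) (encode ((f ^^ n) s)) t"
  using cond bound
proof (induction n arbitrary: s)
  case 0
  obtain t where t: "t \<le> T s" "runs q (encode s) (encode (b s)) t" using test by blast
  then have "runs (While q p) (encode s) (encode s) (1 + esize s + t)"
    using 0(2) by (intro runs.While_False) (simp add: encode_bool_def)
  moreover have "1 + esize s + t \<le> B" using 0(3)[of 0] t by simp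
  ultimately show ?case by auto
next
  case (Suc n)
  obtain t where t: "t \<le> T s" "runs q (encode s) (encode (b s)) t" using test by blast
  obtain u where u: "u \<le> T' s" "runs p (encode s) (encode (f s)) u"
    using body Suc.prems(1)[of 0] by auto
  have "\<exists>t\<le>(n + 1) * B. runs (While q p) (encode (f s)) (encode ((f ^^ n) (f s))) t"
  proof (rule Suc.IH)
    show "b ((f ^^ i) (f s))" if "i < n" for i
      using Suc.prems(1)[of "Suc i"] that by (simp add: funpow_swap1)
    show "\<not> b ((f ^^ n) (f s))" using Suc.prems(2) by (simp add: funpow_swap1)
    show "1 + esize ((f ^^ i) (f s)) + T ((f ^^ i) (f s)) + T' ((f ^^ i) (f s)) \<le> B"
      if "i \<le> n" for i
      using Suc.prems(3)[of "Suc i"] that by (simp add: funpow_swap1)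
  qed
  then obtain v where v: "v \<le> (n + 1) * B"
    "runs (While q p) (encode (f s)) (encode ((f ^^ Suc n) s)) v"
    by (auto simp: funpow_swap1)
  have "runs (While q p) (encode s) (encode ((f ^^ Suc n) s)) (1 + esize s + t + u + v)"
    using t(2) u(2) v(2) Suc.prems(1)[of 0]
    by (intro runs.While_True[where c = "encode (b s)"]) (auto simp: encode_bool_def)
  moreover have "1 + esize s + t + u + v \<le> (Suc n + 1) * B"
    using Suc.prems(3)[of 0] t(1) u(1) v(1) by simp
  ultimately show ?case by blast
qed

lemma esize_foldl_le:
  assumes "\<And>a y. esize (step a y) \<le> esize a + g y"
  shows "esize (foldl step a ys) \<le> esize a + sum_list (map g ys)"
proof (induction ys arbitrary: a)
  case (Cons y ys)
  show ?case using Cons[of "step a y"] assms[of a y] by simp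
qed simp

lemma esize_drop: "esize (drop i xs) \<le> esize xs"
proof (induction xs arbitrary: i)
  case (Cons x xs)
  show ?case using Cons[of "i - 1"] by (cases i) auto
qed simp

text \<open>Polynomial-time steps alone are not enough: repeated squaring doubles the number of
  digits each time. So the accumulator may grow only by an amount \<open>G\<close> that does not
  depend on it. The parameter \<open>x\<close> travels in the loop state, which lets the step depend
  on the whole input.\<close>

lemma ptime_foldl:
  fixes step :: "'x::encodable \<Rightarrow> 'a::encodable \<Rightarrow> 'y::encodable \<Rightarrow> 'a"
  assumes xs: "ptime xs" and init: "ptime init"
    and step: "ptime (\<lambda>p. step (fst p) (fst (snd p)) (snd (snd p)))"
    and growth: "poly_bounded G" "\<And>x a y. esize (step x a y) \<le> esize a + G (x, y)"
  shows "ptime (\<lambda>x. foldl (step x) (init x) (xs x))"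
proof -
  define f where "f = (\<lambda>s :: 'x \<times> 'y list \<times> 'a.
    (fst s, tl (fst (snd s)), step (fst s) (snd (snd s)) (hd (fst (snd s)))))"
  define b where "b = (\<lambda>s :: 'x \<times> 'y list \<times> 'a. fst (snd s) \<noteq> [])"
  have "ptime b"
    unfolding b_def by (intro ptime_comp[OF ptime_not_Nil] ptime_fst ptime_snd ptime_id)
  then obtain q T where q: "poly_bounded T" "\<And>s. \<exists>t\<le>T s. runs q (encode s) (encode (b s)) t"
    by (rule ptimeE) blast
  \<comment> \<open>The body \<open>f\<close> with \<open>hd\<close> and \<open>tl\<close> is
    realised at the type where the list is a pair of head and tail. On nonempty lists the two
    encodings coincide, and the body is run only on those.\<close>
  have "ptime (\<lambda>s :: 'x \<times> ('y \<times> 'y list) \<times> 'a.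
      (fst s, snd (fst (snd s)), step (fst s) (snd (snd s)) (fst (fst (snd s)))))"
    by (intro ptime_Pair ptime_fst ptime_snd ptime_id
        ptime_comp[OF step, of "\<lambda>s. (fst s, snd (snd s), fst (fst (snd s)))", simplified])
  then obtain p T' where p: "poly_bounded T'" "\<And>s :: 'x \<times> ('y \<times> 'y list) \<times> 'a. \<exists>t\<le>T' s.
      runs p (encode s)
        (encode (fst s, snd (fst (snd s)), step (fst s) (snd (snd s)) (fst (fst (snd s))))) t"
    by (rule ptimeE) blast
  obtain c d where T: "\<And>s. T s \<le> c * esize s ^ d"
    using q(1) unfolding poly_bounded_def by blast
  obtain c' d' where T': "\<And>s. T' s \<le> c' * esize s ^ d'"
    using p(1) unfolding poly_bounded_def by blast
  obtain k m where G: "\<And>z. G z \<le> k * esize z ^ m"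
    using growth(1) unfolding poly_bounded_def by blast
  have body: "\<exists>t\<le>c' * esize s ^ d'. runs p (encode s) (encode (f s)) t" if "b s" for s
  proof -
    obtain x zs a where "s = (x, zs, a)" by (rule prod_cases3)
    moreover from this obtain y ys where "zs = y # ys" using \<open>b s\<close> by (cases zs) (auto simp: b_def)
    ultimately have s: "s = (x, y # ys, a)" by simp
    have "encode s = encode (x, (y, ys), a)" by (simp add: s encode_prod_def encode_Cons)
    moreover
    obtain t where "t \<le> T' (x, (y, ys), a)"
      "runs p (encode (x, (y, ys), a)) (encode (x, ys, step x a y)) t"
      using p(2)[of "(x, (y, ys), a)"] by auto
    ultimately show ?thesis using T'[of "(x, (y, ys), a)"]
      by (intro exI[of _ t]) (simp add: s f_def)
  qed
  have test: "\<exists>t\<le>c * esize s ^ d. runs q (encode s) (encode (b s)) t" for s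
    using q(2)[of s] T[of s] le_trans by blast
  \<comment> \<open>\<open>Z\<close> bounds the size of every state of the loop, \<open>B\<close>
    the cost of one iteration.\<close>
  define Z where "Z = (\<lambda>x. 2 + esize x + esize (xs x) + (esize (init x)
    + esize (xs x) * (k * (1 + esize x + esize (xs x)) ^ m)))"
  define B where "B = (\<lambda>x. 1 + Z x + c * Z x ^ d + c' * Z x ^ d')"
  have Z: "poly_bounded Z"
    unfolding Z_def by (intro poly_bounded_intros ptime_esize xs init)
  have B: "poly_bounded B"
    unfolding B_def by (intro poly_bounded_intros Z)
  have iter: "(f ^^ i) (x, ys, a) = (x, drop i ys, foldl (step x) a (take i ys))"
    if "i \<le> length ys" for i x ys a
    using that
  proof (induction i)
    case (Suc i)
    then show ?case
      by (simp add: f_def take_Suc_conv_app_nth hd_drop_conv_nth drop_Suc tl_drop)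
  qed simp
  have loop: "\<exists>t\<le>(esize (xs x) + 1) * B x. runs (While q p) (encode (x, xs x, init x))
      (encode (x, [] :: 'y list, foldl (step x) (init x) (xs x))) t" for x
  proof -
    let ?s = "(x, xs x, init x)" and ?n = "length (xs x)"
    have "\<exists>t\<le>(?n + 1) * B x. runs (While q p) (encode ?s) (encode ((f ^^ ?n) ?s)) t"
    proof (rule runs_While[OF test body])
      show "b ((f ^^ i) ?s)" if "i < ?n" for i using that by (simp add: iter b_def)
      show "\<not> b ((f ^^ ?n) ?s)" by (simp add: iter b_def)
      show "1 + esize ((f ^^ i) ?s) + c * esize ((f ^^ i) ?s) ^ d + c' * esize ((f ^^ i) ?s) ^ d'
          \<le> B x" if "i \<le> ?n" for i
      proof -
        have "esize (foldl (step x) (init x) (take i (xs x)))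
            \<le> esize (init x) + sum_list (map (\<lambda>y. G (x, y)) (take i (xs x)))"
          by (rule esize_foldl_le) (rule growth(2))
        also have "sum_list (map (\<lambda>y. G (x, y)) (take i (xs x)))
            \<le> sum_list (map (\<lambda>_. k * (1 + esize x + esize (xs x)) ^ m) (take i (xs x)))"
        proof (rule sum_list_mono)
          fix y assume "y \<in> set (take i (xs x))"
          then have "esize (x, y) \<le> 1 + esize x + esize (xs x)"
            using esize_mem[of y "xs x"] by (auto dest: in_set_takeD)
          then show "G (x, y) \<le> k * (1 + esize x + esize (xs x)) ^ m"
            using G[of "(x, y)"] by (meson le_trans mult_le_mono2 power_mono zero_le)
        qed
        also have "\<dots> \<le> esize (xs x) * (k * (1 + esize x + esize (xs x)) ^ m)"
          using length_le_esize[of "xs x"] by (auto simp: sum_list_triv intro: min.coboundedI1)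
        finally have "esize ((f ^^ i) ?s) \<le> Z x"
          using esize_drop[of i "xs x"] that by (simp add: iter Z_def)
        then show ?thesis
          unfolding B_def by (intro add_mono mult_le_mono2 power_mono) auto
      qed
    qed
    then obtain t where t: "t \<le> (?n + 1) * B x"
      "runs (While q p) (encode ?s) (encode ((f ^^ ?n) ?s)) t"
      by blast
    note t(1)
    also have "(?n + 1) * B x \<le> (esize (xs x) + 1) * B x"
      by (intro mult_le_mono1 add_le_mono1 length_le_esize)
    finally have "t \<le> (esize (xs x) + 1) * B x" .
    moreover have "(f ^^ ?n) ?s = (x, [], foldl (step x) (init x) (xs x))"
      by (simp add: iter)
    ultimately show ?thesis using t(2) by auto
  qed
  obtain r R where r: "poly_bounded R" "\<And>x. \<exists>t\<le>R x. runs r (encode x) (encode (x, xs x, init x)) t"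
    using ptime_Pair[OF ptime_id ptime_Pair[OF xs init]] by (rule ptimeE) blast
  have "ptime (\<lambda>s :: 'x \<times> 'y list \<times> 'a. snd (snd s))"
    by (intro ptime_snd ptime_id)
  then obtain e E where e: "poly_bounded E"
    "\<And>s :: 'x \<times> 'y list \<times> 'a. \<exists>t\<le>E s. runs e (encode s) (encode (snd (snd s))) t"
    by (rule ptimeE) blast
  \<comment> \<open>The size of the final state is bounded through the running time of the loop that
    wrote it.\<close>
  have Z_final: "esize (x, [] :: 'y list, foldl (step x) (init x) (xs x)) \<le> (esize (xs x) + 1) * B x" for x
    using loop[of x] bitsize_le_time le_trans by blast
  obtain k' m' where E: "\<And>s. E s \<le> k' * esize s ^ m'"
    using e(1) unfolding poly_bounded_def by blast
  let ?bound = "\<lambda>x. 1 + esize x + R x + (1 + esize (x, xs x, init x) + (esize (xs x) + 1) * B x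
    + k' * ((esize (xs x) + 1) * B x) ^ m')"
  show ?thesis
  proof (rule ptimeI[where p = "Seq r (Seq (While q p) e)" and T = ?bound])
    show "poly_bounded ?bound"
      by (intro poly_bounded_intros r(1) B ptime_esize ptime_Pair ptime_id xs init)
    fix x
    obtain t1 where t1: "t1 \<le> R x" "runs r (encode x) (encode (x, xs x, init x)) t1"
      using r(2) by blast
    obtain t2 where t2: "t2 \<le> (esize (xs x) + 1) * B x" "runs (While q p) (encode (x, xs x, init x))
        (encode (x, [] :: 'y list, foldl (step x) (init x) (xs x))) t2"
      using loop by blast
    obtain t3 where t3: "t3 \<le> E (x, [] :: 'y list, foldl (step x) (init x) (xs x))"
      "runs e (encode (x, [] :: 'y list, foldl (step x) (init x) (xs x)))
        (encode (foldl (step x) (init x) (xs x))) t3"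
      using e(2)[of "(x, [], foldl (step x) (init x) (xs x))"] by auto
    note t3(1)
    also have "E (x, [] :: 'y list, foldl (step x) (init x) (xs x))
        \<le> k' * ((esize (xs x) + 1) * B x) ^ m'"
      by (rule le_trans[OF E]) (intro mult_le_mono2 power_mono Z_final zero_le)
    finally have t3': "t3 \<le> k' * ((esize (xs x) + 1) * B x) ^ m'" .
    have "runs (Seq r (Seq (While q p) e)) (encode x) (encode (foldl (step x) (init x) (xs x)))
        (1 + esize x + t1 + (1 + esize (x, xs x, init x) + t2 + t3))"
      by (intro runs.Seq[OF t1(2)] runs.Seq[OF t2(2)] t3(2))
    moreover have "1 + esize x + t1 + (1 + esize (x, xs x, init x) + t2 + t3) \<le> ?bound x"
      using t1(1) t2(1) t3' by simp
    ultimately show "\<exists>t\<le>?bound x. runs (Seq r (Seq (While q p) e)) (encode x)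
        (encode (foldl (step x) (init x) (xs x))) t"
      by blast
  qed
qed

section \<open>List operations\<close>

lemma ptime_rev:
  assumes "ptime xs"
  shows "ptime (\<lambda>x. rev (xs x))"
proof -
  have "ptime (\<lambda>x. foldl (\<lambda>a y. y # a) [] (xs x))"
    by (rule ptime_foldl[OF assms ptime_const,
          where G = "\<lambda>z. 1 + esize (snd z)"])
      (auto intro!: ptime_Cons ptime_snd ptime_fst ptime_id poly_bounded_intros ptime_esize)
  moreover have "foldl (\<lambda>a y. y # a) b ys = rev ys @ b" for b ys :: "'b list"
    by (induction ys arbitrary: b) auto
  ultimately show ?thesis by simp
qed

lemma ptime_map:
  assumes "ptime (\<lambda>p. f (fst p) (snd p))" "ptime xs"
  shows "ptime (\<lambda>x. map (f x) (xs x))"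
proof -
  have "ptime (\<lambda>x. rev (foldl (\<lambda>a y. f x y # a) [] (xs x)))"
    by (rule ptime_rev, rule ptime_foldl[OF assms(2) ptime_const,
          where G = "\<lambda>z. 1 + esize (f (fst z) (snd z))"])
      (auto intro!: ptime_Cons ptime_snd ptime_fst ptime_id poly_bounded_intros ptime_esize assms
        ptime_comp[OF assms(1), of "\<lambda>p. (fst p, snd (snd p))", simplified] ptime_Pair)
  moreover have "foldl (\<lambda>a y. g y # a) b ys = rev (map g ys) @ b" for b ys and g :: "'b \<Rightarrow> 'c"
    by (induction ys arbitrary: b) auto
  ultimately show ?thesis by simp
qed

lemma ptime_filter:
  assumes "ptime (\<lambda>p. P (fst p) (snd p))" "ptime xs"
  shows "ptime (\<lambda>x. filter (P x) (xs x))"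
proof -
  have "ptime (\<lambda>x. rev (foldl (\<lambda>a y. if P x y then y # a else a) [] (xs x)))"
    by (rule ptime_rev, rule ptime_foldl[OF assms(2) ptime_const,
          where G = "\<lambda>z. 1 + esize (snd z)"])
      (auto intro!: ptime_Cons ptime_snd ptime_fst ptime_id poly_bounded_intros ptime_esize ptime_if
        ptime_comp[OF assms(1), of "\<lambda>p. (fst p, snd (snd p))", simplified] ptime_Pair)
  moreover have "foldl (\<lambda>a y. if Q y then y # a else a) b ys = rev (filter Q ys) @ b"
    for b ys and Q :: "'b \<Rightarrow> bool"
    by (induction ys arbitrary: b) auto
  ultimately show ?thesis by simp
qed

lemma ptime_append:
  assumes "ptime xs" "ptime ys"
  shows "ptime (\<lambda>x. xs x @ ys x)"
proof -
  have "ptime (\<lambda>x. foldl (\<lambda>a y. y # a) (ys x) (rev (xs x)))"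
    by (rule ptime_foldl[OF ptime_rev[OF assms(1)] assms(2),
          where G = "\<lambda>z. 1 + esize (snd z)"])
      (auto intro!: ptime_Cons ptime_snd ptime_fst ptime_id poly_bounded_intros ptime_esize)
  moreover have "foldl (\<lambda>a y. y # a) b ys = rev ys @ b" for b ys :: "'b list"
    by (induction ys arbitrary: b) auto
  ultimately show ?thesis by simp
qed

lemma esize_append: "esize (xs @ ys) \<le> esize xs + esize ys"
  by (induction xs) (auto simp: esize_Nil)

lemma ptime_concat:
  assumes "ptime xs"
  shows "ptime (\<lambda>x. concat (xs x))"
proof -
  have "ptime (\<lambda>x. foldl (@) [] (xs x))"
    by (rule ptime_foldl[OF assms ptime_const, where G = "\<lambda>z. esize (snd z)"])
      (auto intro!: ptime_append ptime_snd ptime_fst ptime_id poly_bounded_intros ptime_esize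
        esize_append)
  moreover have "foldl (@) b yss = b @ concat yss" for b and yss :: "'b list list"
    by (induction yss arbitrary: b) auto
  ultimately show ?thesis by simp
qed

lemma ptime_sum_list:
  assumes "ptime xs"
  shows "ptime (\<lambda>x. sum_list (xs x) :: int)"
proof -
  have "ptime (\<lambda>x. foldl (+) 0 (xs x))"
    by (rule ptime_foldl[OF assms ptime_const, where G = "\<lambda>z. esize (snd z)"])
      (auto intro!: ptime_add ptime_snd ptime_fst ptime_id poly_bounded_intros ptime_esize
        esize_int_add)
  moreover have "foldl (+) b ys = b + sum_list ys" for b and ys :: "int list"
    by (induction ys arbitrary: b) auto
  ultimately show ?thesis by simp
qed

text \<open>Under multiplication bit sizes add, so the accumulator grows by at most the size of the
  new factor, as \<open>ptime_foldl\<close> demands. This allows the product of all denominators as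
  a common denominator.\<close>

lemma ptime_prod_list:
  assumes "ptime xs"
  shows "ptime (\<lambda>x. prod_list (xs x) :: int)"
proof -
  have "ptime (\<lambda>x. foldl (*) 1 (xs x))"
    by (rule ptime_foldl[OF assms ptime_const, where G = "\<lambda>z. esize (snd z)"])
      (auto intro!: ptime_mult ptime_snd ptime_fst ptime_id poly_bounded_intros ptime_esize
        esize_int_mult)
  moreover have "foldl (*) b ys = b * prod_list ys" for b and ys :: "int list"
    by (induction ys arbitrary: b) auto
  ultimately show ?thesis by simp
qed

lemma ptime_mem:
  fixes i :: "'a::encodable \<Rightarrow> int"
  assumes "ptime i" "ptime xs"
  shows "ptime (\<lambda>x. i x \<in> set (xs x))"
proof -
  have "ptime (\<lambda>x. foldl (\<lambda>b y. b \<or> y = i x) False (xs x))"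
    by (rule ptime_foldl[OF assms(2) ptime_const, where G = "\<lambda>_. 2"])
      (auto intro!: ptime_disj ptime_eq ptime_snd ptime_fst ptime_id poly_bounded_intros
        ptime_comp[OF assms(1)] le_trans[OF esize_bool])
  moreover have "foldl (\<lambda>b y. b \<or> y = k) b ys \<longleftrightarrow> b \<or> k \<in> set ys" for b k and ys :: "int list"
    by (induction ys arbitrary: b) auto
  ultimately show ?thesis by simp
qed

text \<open>\<open>K\<close> is fixed and not part of the input, so the sum is unrolled into the
  program.\<close>

lemma ptime_sum_lessThan:
  assumes "\<And>j :: nat. ptime (f j)"
  shows "ptime (\<lambda>x. \<Sum>j<K. f j x :: int)"
  by (induction K) (auto intro!: ptime_const ptime_add assms)

section \<open>List access and minimisation over lists, as folds\<close>

definition lookup :: "'a \<Rightarrow> 'a list \<Rightarrow> int \<Rightarrow> 'a" where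
  "lookup d xs i = (if 0 \<le> i \<and> i < int (length xs) then xs ! nat i else d)"

lemma lookup_nth: "i < length xs \<Longrightarrow> lookup d xs (int i) = xs ! i"
  by (simp add: lookup_def)

text \<open>The first component counts down and the entry met at 0 is stored. A negative index never
  reaches 0, which leaves the default.\<close>

lemma lookup_eq_foldl:
  "lookup d xs i = snd (foldl (\<lambda>a y. (fst a - 1, if fst a = 0 then y else snd a)) (i, d) xs)"
proof (induction xs arbitrary: i d)
  case (Cons x xs)
  have "lookup d (x # xs) i = lookup (if i = 0 then x else d) xs (i - 1)"
    by (auto simp: lookup_def nth_Cons' nat_diff_distrib)
  then show ?case by (simp add: Cons)
qed (auto simp: lookup_def)

lemma ptime_lookup:
  assumes "ptime d" "ptime xs" "ptime i"
  shows "ptime (\<lambda>x. lookup (d x) (xs x) (i x))"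
  unfolding lookup_eq_foldl
proof (rule ptime_snd, rule ptime_foldl[OF assms(2) ptime_Pair[OF assms(3,1)],
      where G = "\<lambda>z. 2 + esize (snd z)"])
  fix a :: "int \<times> 'b" and y :: 'b
  show "esize (fst a - 1, if fst a = 0 then y else snd a) \<le> esize a + (2 + esize (snd (x, y)))" for x :: 'a
    using esize_int_diff[of "fst a" 1]
    by (cases a) (auto simp: encode_int_def floorlog_def)
qed (auto intro!: ptime_Pair ptime_diff ptime_if ptime_eq ptime_snd ptime_fst ptime_id ptime_const
      poly_bounded_intros ptime_esize)

text \<open>An arg min that is total because \<open>d\<close> competes with the list. It is always
  called with the first entry of the list as \<open>d\<close>, which adds no new candidate when the
  list is nonempty.\<close>

definition best :: "('a \<Rightarrow> int) \<Rightarrow> 'a \<Rightarrow> 'a list \<Rightarrow> 'a" where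
  "best f = foldl (\<lambda>a y. if f y < f a then y else a)"

lemma best_mem: "best f d xs \<in> insert d (set xs)"
  unfolding best_def by (induction xs arbitrary: d) (auto split: if_splits)

lemma best_le: "y \<in> insert d (set xs) \<Longrightarrow> f (best f d xs) \<le> f y"
  unfolding best_def
proof (induction xs arbitrary: d y)
  case (Cons x xs)
  show ?case
  proof (cases "y \<in> {d, x}")
    case True
    have "f (best f (if f x < f d then x else d) xs) \<le> f (if f x < f d then x else d)"
      unfolding best_def by (rule Cons.IH) simp
    then show ?thesis using True by (auto simp: best_def split: if_splits)
  next
    case False
    then show ?thesis using Cons by simp
  qed
qed simp

lemma ptime_best:
  assumes "ptime (\<lambda>p. f (fst p) (snd p))" "ptime d" "ptime xs"
  shows "ptime (\<lambda>x. best (f x) (d x) (xs x))"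
  unfolding best_def
  by (rule ptime_foldl[OF assms(3,2), where G = "\<lambda>z. esize (snd z)"])
    (auto intro!: ptime_if ptime_less ptime_snd ptime_fst ptime_id poly_bounded_intros ptime_esize
      ptime_comp[OF assms(1), of "\<lambda>p. (fst p, snd (snd p))", simplified]
      ptime_comp[OF assms(1), of "\<lambda>p. (fst p, fst (snd p))", simplified] ptime_Pair)

lemmas ptime_intros =
  ptime_const ptime_id ptime_fst ptime_snd ptime_Pair ptime_if ptime_add ptime_diff ptime_mult
  ptime_div ptime_le ptime_less ptime_eq ptime_conj ptime_disj ptime_not ptime_Cons ptime_map
  ptime_filter ptime_concat ptime_append ptime_sum_list ptime_prod_list ptime_mem
  ptime_sum_lessThan ptime_lookup ptime_best

section \<open>Counting\<close>

lemma esize_int_le_nat: "esize (int n) \<le> 2 + n"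
proof -
  have "\<bar>int n\<bar> < 2 ^ (1 + n)"
    using less_exp[of "1 + n"] by (metis Suc_lessD abs_of_nat of_nat_less_numeral_power_cancel_iff plus_1_eq_Suc)
  from esize_int_le[OF this] show ?thesis by simp
qed

lemma esize_upto: "esize [int i..int n] \<le> 1 + (n + 1) * (3 + n)"
proof -
  have "esize xs \<le> 1 + length xs * (3 + n)" if "set xs \<subseteq> {0..int n}" for xs
    using that
  proof (induction xs)
    case (Cons x xs)
    then have "esize x \<le> 2 + n" using esize_int_le_nat[of "nat x"] by auto
    then show ?case using Cons by simp
  qed (simp add: esize_Nil)
  from this[of "[int i..int n]"] have "esize [int i..int n] \<le> 1 + length [int i..int n] * (3 + n)"
    by auto
  also have "\<dots> \<le> 1 + (n + 1) * (3 + n)"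
    by (intro add_left_mono mult_le_mono1) auto
  finally show ?thesis .
qed

text \<open>Unlike the operations above, this takes time exponential in the size of its input.\<close>

lemma runs_upto:
  "\<exists>p T. poly_bounded T \<and>
    (\<forall>n. \<exists>t\<le>T [0..int n]. runs p (encode (int n)) (encode [0..int n]) t)"
proof -
  define f where "f = (\<lambda>s :: int \<times> int list. (fst s - 1, fst s # snd s))"
  define b where "b = (\<lambda>s :: int \<times> int list. 0 \<le> fst s)"
  have "ptime b" "ptime f" unfolding b_def f_def by (intro ptime_intros)+
  then obtain q S p T where
    q: "poly_bounded S" "\<And>s. \<exists>t\<le>S s. runs q (encode s) (encode (b s)) t" and
    p: "poly_bounded T" "\<And>s. \<exists>t\<le>T s. runs p (encode s) (encode (f s)) t"
    unfolding ptime_def by blast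
  obtain c d where S: "\<And>s. S s \<le> c * esize s ^ d"
    using q(1) unfolding poly_bounded_def by blast
  obtain c' d' where T: "\<And>s. T s \<le> c' * esize s ^ d'"
    using p(1) unfolding poly_bounded_def by blast
  define Z where "Z = (\<lambda>n :: nat. 3 + n + (1 + (n + 2) * (3 + n)))"
  define B where "B = (\<lambda>n. 1 + Z n + c * Z n ^ d + c' * Z n ^ d')"
  \<comment> \<open>Counting down from \<open>n\<close> puts the list in ascending order at once;
    after \<open>n + 1\<close> rounds the counter is at \<open>- 1\<close>.\<close>
  have iter: "(f ^^ i) (int n, []) = (int n - int i, [int n - int i + 1..int n])"
    if "i \<le> n + 1" for i n
    using that
  proof (induction i)
    case (Suc i)
    then show ?case by (simp add: f_def upto_rec1)
  qed simp
  have loop: "\<exists>t\<le>(n + 1 + 1) * B n. runs (While q p) (encode (int n, [] :: int list))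
      (encode (- 1 :: int, [0..int n])) t" for n
  proof -
    have "\<exists>t\<le>(n + 1 + 1) * B n. runs (While q p) (encode (int n, [] :: int list))
        (encode ((f ^^ (n + 1)) (int n, []))) t"
    proof (rule runs_While[OF q(2) p(2)])
      show "b ((f ^^ i) (int n, []))" if "i < n + 1" for i
        using that iter[of i n] by (simp add: b_def)
      show "\<not> b ((f ^^ (n + 1)) (int n, []))"
        unfolding iter[OF order_refl] by (simp add: b_def)
      fix i assume i: "i \<le> n + 1"
      let ?s = "(f ^^ i) (int n, [])"
      have "esize (int n - int i) \<le> 2 + n"
      proof (cases "i \<le> n")
        case True
        then show ?thesis using esize_int_le_nat[of "n - i"] by (simp add: of_nat_diff)
      next
        case False
        then have "int n - int i = - 1" using i by simp
        then show ?thesis by (simp add: encode_int_def floorlog_def compute_floorlog)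
      qed
      moreover have "esize [int n - int i + 1..int n] \<le> 1 + (n + 1) * (3 + n)"
        using esize_upto[of "n + 1 - i" n] i by (simp add: of_nat_diff algebra_simps)
      ultimately have "esize ?s \<le> Z n"
        by (simp add: iter[OF i] Z_def)
      then have "S ?s \<le> c * Z n ^ d" "T ?s \<le> c' * Z n ^ d'"
        using S[of ?s] T[of ?s] by (meson le_trans mult_le_mono2 power_mono zero_le)+
      then show "1 + esize ?s + S ?s + T ?s \<le> B n"
        using \<open>esize ?s \<le> Z n\<close> by (simp add: B_def)
    qed
    then show ?thesis unfolding iter[OF order_refl] by simp
  qed
  have "ptime (\<lambda>n :: int. (n, [] :: int list))" "ptime (\<lambda>s :: int \<times> int list. snd s)"
    by (intro ptime_intros)+
  then obtain r R e E where
    r: "poly_bounded R" "\<And>n :: int. \<exists>t\<le>R n. runs r (encode n) (encode (n, [] :: int list)) t" and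
    e: "poly_bounded E" "\<And>s :: int \<times> int list. \<exists>t\<le>E s. runs e (encode s) (encode (snd s)) t"
    unfolding ptime_def by blast
  \<comment> \<open>The time is measured against the output: it has \<open>n + 1\<close> entries, so
    about \<open>n\<close> iterations are linear in its size.\<close>
  have len: "n \<le> esize [0..int n]" for n
    using length_le_esize[of "[0..int n]"] by simp
  obtain k m where R: "\<And>s. R s \<le> k * esize s ^ m"
    using r(1) unfolding poly_bounded_def by blast
  obtain k' m' where E: "\<And>s. E s \<le> k' * esize s ^ m'"
    using e(1) unfolding poly_bounded_def by blast
  define V where "V = (\<lambda>xs :: int list.
     1 + (2 + esize xs) + k * (2 + esize xs) ^ m + (1 + (4 + esize xs)
     + (esize xs + 1 + 1) * B (esize xs) + k' * (4 + esize xs) ^ m'))"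
  have "poly_bounded V"
    unfolding V_def B_def Z_def by (intro poly_bounded_intros)
  moreover have "\<exists>t\<le>V [0..int n]. runs (Seq r (Seq (While q p) e)) (encode (int n)) (encode [0..int n]) t" for n
  proof -
    let ?L = "esize [0..int n]"
    obtain t1 where t1: "t1 \<le> R (int n)" "runs r (encode (int n)) (encode (int n, [] :: int list)) t1"
      using r(2) by blast
    obtain t2 where t2: "t2 \<le> (n + 1 + 1) * B n" "runs (While q p) (encode (int n, [] :: int list))
      (encode (- 1 :: int, [0..int n])) t2"
      using loop by blast
    obtain t3 where t3: "t3 \<le> E (- 1, [0..int n])" "runs e (encode (- 1 :: int, [0..int n])) (encode [0..int n]) t3"
      using e(2)[of "(- 1, [0..int n])"] by auto
    have n: "esize (int n) \<le> 2 + ?L" using esize_int_le_nat[of n] len[of n] by linarith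
    have "t1 \<le> k * (2 + ?L) ^ m"
      using t1(1) R[of "int n"] n by (meson le_trans mult_le_mono2 power_mono zero_le)
    moreover have "B n \<le> B ?L"
      unfolding B_def Z_def by (intro add_mono mult_le_mono power_mono order_refl len) auto
    then have "t2 \<le> (?L + 1 + 1) * B ?L"
      using t2(1) len[of n] by (meson add_le_mono1 le_trans mult_le_mono)
    moreover have "esize (- 1 :: int, [0..int n]) \<le> 4 + ?L"
      by (simp add: encode_int_def compute_floorlog floorlog_def)
    then have "t3 \<le> k' * (4 + ?L) ^ m'"
      using t3(1) E[of "(- 1, [0..int n])"] by (meson le_trans mult_le_mono2 power_mono zero_le)
    moreover have "esize (int n, [] :: int list) \<le> 4 + ?L"
      using n by (simp add: esize_Nil)
    ultimately have "1 + esize (int n) + t1 + (1 + esize (int n, [] :: int list) + t2 + t3) \<le> V [0..int n]"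
      using n unfolding V_def by linarith
    moreover have "runs (Seq r (Seq (While q p) e)) (encode (int n)) (encode [0..int n])
        (1 + esize (int n) + t1 + (1 + esize (int n, [] :: int list) + t2 + t3))"
      by (intro runs.Seq[OF t1(2)] runs.Seq[OF t2(2)] t3(2))
    ultimately show ?thesis by blast
  qed
  ultimately show ?thesis by blast
qed

text \<open>Counting is split off, so that \<open>alg\<close> need only be polynomial in an input
  that already contains the list, that is, in \<open>N x\<close> itself rather than in its number of
  digits. This is where the dependence on 1/eps comes from.\<close>

lemma runs_with_upto:
  fixes N :: "'a::encodable \<Rightarrow> int" and alg :: "'a \<times> int list \<Rightarrow> 'b::encodable"
  assumes "ptime N" "ptime alg"
  shows "\<exists>p c d. \<forall>x. N x \<ge> 0 \<longrightarrow>
    (\<exists>t\<le>c * (esize x + nat (N x)) ^ d. runs p (encode x) (encode (alg (x, [0..N x]))) t)"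
proof -
  obtain q T where q: "poly_bounded T"
    "\<And>n. \<exists>t\<le>T [0..int n]. runs q (encode (int n)) (encode [0..int n]) t"
    using runs_upto by blast
  have "ptime (\<lambda>x. (x, N x))" by (intro ptime_intros assms)
  then obtain r R where r: "poly_bounded R" "\<And>x. \<exists>t\<le>R x. runs r (encode x) (encode (x, N x)) t"
    unfolding ptime_def by blast
  obtain a S where a: "poly_bounded S" "\<And>z. \<exists>t\<le>S z. runs a (encode z) (encode (alg z)) t"
    using assms(2) unfolding ptime_def by blast
  define V where "V = (\<lambda>z :: 'a \<times> int list. 1 + esize (fst z) + R (fst z) +
    (1 + esize (fst z, N (fst z)) + (1 + esize (fst z, N (fst z)) +
      (1 + esize (fst z, N (fst z)) + esize (fst z)) +
      (1 + esize (fst z, N (fst z)) + (1 + esize (fst z, N (fst z)) + esize (N (fst z))) + T (snd z)))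
    + S z))"
  have V: "poly_bounded V"
    unfolding V_def by (intro poly_bounded_intros a(1) ptime_esize ptime_intros
        poly_bounded_comp[OF r(1)] poly_bounded_comp[OF q(1)] ptime_comp[OF assms(1)])
  have run: "\<exists>t\<le>V (x, [0..N x]). runs (Seq r (Seq (Both (Prim Fst) (Seq (Prim Snd) q)) a))
      (encode x) (encode (alg (x, [0..N x]))) t" if "N x \<ge> 0" for x
  proof -
    obtain t1 where t1: "t1 \<le> R x" "runs r (encode x) (encode (x, N x)) t1"
      using r(2) by blast
    have "int (nat (N x)) = N x" using that by simp
    with q(2)[of "nat (N x)"]
    obtain t2 where t2: "t2 \<le> T [0..N x]" "runs q (encode (N x)) (encode [0..N x]) t2"
      by auto
    obtain t3 where t3: "t3 \<le> S (x, [0..N x])"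
      "runs a (encode (x, [0..N x])) (encode (alg (x, [0..N x]))) t3"
      using a(2) by blast
    have "runs (Prim Fst) (encode (x, N x)) (encode x) (1 + esize (x, N x) + esize x)"
      "runs (Prim Snd) (encode (x, N x)) (encode (N x)) (1 + esize (x, N x) + esize (N x))"
      by (rule runs.Prim, simp add: encode_prod_def)+
    note pr = this
    have b: "runs (Both (Prim Fst) (Seq (Prim Snd) q)) (encode (x, N x)) (encode (x, [0..N x]))
        (1 + esize (x, N x) + (1 + esize (x, N x) + esize x) +
         (1 + esize (x, N x) + (1 + esize (x, N x) + esize (N x)) + t2))"
      using runs.Both[OF pr(1) runs.Seq[OF pr(2) t2(2)]] by (simp add: encode_prod_def)
    from runs.Seq[OF t1(2) runs.Seq[OF b t3(2)]] show ?thesis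
      by (rule exI[of _ "_ :: nat", OF conjI[rotated]]) (use t1(1) t2(1) t3(1) in \<open>simp add: V_def\<close>)
  qed
  obtain k m where k: "\<And>z. V z \<le> k * esize z ^ m"
    using V unfolding poly_bounded_def by blast
  have "k * esize (x, [0..N x]) ^ m \<le> (k * 8 ^ m) * (esize x + nat (N x)) ^ (2 * m)"
    if "N x \<ge> 0" for x
  proof -
    let ?w = "esize x + nat (N x)"
    \<comment> \<open>The list has \<open>N x + 1\<close> entries, each of size at most linear in
      \<open>N x\<close>; the resulting quadratic bound is the reason for the exponent
      \<open>2 * m\<close>.\<close>
    have "esize (x, [0..N x]) \<le> 1 + esize x + (1 + (nat (N x) + 1) * (3 + nat (N x)))"
      using esize_upto[of 0 "nat (N x)"] that by simp
    also have "\<dots> \<le> 8 * (?w * ?w)"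
    proof -
      have "1 \<le> esize x" by (rule esize_pos)
      then obtain s where s: "esize x = Suc s" by (cases "esize x") auto
      show ?thesis unfolding s by (simp add: algebra_simps)
    qed
    finally have "esize (x, [0..N x]) ^ m \<le> (8 * (?w * ?w)) ^ m" by (rule power_mono) simp
    also have "\<dots> = 8 ^ m * ?w ^ (2 * m)"
      by (simp add: power_mult_distrib power_mult power2_eq_square)
    finally show ?thesis by simp
  qed
  then have "\<forall>x. N x \<ge> 0 \<longrightarrow> (\<exists>t\<le>(k * 8 ^ m) * (esize x + nat (N x)) ^ (2 * m).
      runs (Seq r (Seq (Both (Prim Fst) (Seq (Prim Snd) q)) a))
        (encode x) (encode (alg (x, [0..N x]))) t)"
    using run k le_trans by meson
  then show ?thesis by blast
qed

section \<open>Lagrangian duality for budget constraints\<close>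

text \<open>The multiplier is the supremum of the slopes \<open>(F u - V) / g u\<close> over the
  points that violate the constraint. \<open>penalty\<close> keeps these slopes at most 1, which
  does the work of a Slater point; concavity puts each of them below the bound
  \<open>(V - F u) / (- g u)\<close> set by a strictly feasible \<open>u\<close>.\<close>

lemma lagrange_multiplier:
  fixes F g :: "('i \<Rightarrow> real) \<Rightarrow> real"
  assumes D: "\<And>u v a. u \<in> D \<Longrightarrow> v \<in> D \<Longrightarrow> 0 \<le> a \<Longrightarrow> a \<le> 1 \<Longrightarrow> (\<lambda>i. a * u i + (1 - a) * v i) \<in> D"
    and F: "\<And>u v a. u \<in> D \<Longrightarrow> v \<in> D \<Longrightarrow> 0 \<le> a \<Longrightarrow> a \<le> 1 \<Longrightarrow>
      a * F u + (1 - a) * F v \<le> F (\<lambda>i. a * u i + (1 - a) * v i)"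
    and g: "\<And>u v a. u \<in> D \<Longrightarrow> v \<in> D \<Longrightarrow> 0 \<le> a \<Longrightarrow> a \<le> 1 \<Longrightarrow>
      g (\<lambda>i. a * u i + (1 - a) * v i) \<le> a * g u + (1 - a) * g v"
    and feasible: "\<And>u. u \<in> D \<Longrightarrow> g u \<le> 0 \<Longrightarrow> F u \<le> V"
    and penalty: "\<And>u. u \<in> D \<Longrightarrow> 0 < g u \<Longrightarrow> F u \<le> V + g u"
  shows "\<exists>l. 0 \<le> l \<and> l \<le> 1 \<and> (\<forall>u\<in>D. F u - l * g u \<le> V)"
proof -
  \<comment> \<open>The element 0 makes the multiplier nonnegative and the set nonempty when no
    point violates the constraint.\<close>
  define A where "A = insert 0 {(F u - V) / g u | u. u \<in> D \<and> 0 < g u}"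
  have le1: "a \<le> 1" if "a \<in> A" for a
    using that penalty by (auto simp: A_def divide_le_eq algebra_simps)
  then have bdd: "bdd_above A" by (rule bdd_aboveI)
  have "F u - Sup A * g u \<le> V" if u: "u \<in> D" for u
  proof (cases "g u" "0 :: real" rule: linorder_cases)
    case greater
    then have "(F u - V) / g u \<le> Sup A" using u by (intro cSup_upper bdd) (auto simp: A_def)
    then show ?thesis using greater by (simp add: divide_le_eq algebra_simps)
  next
    case equal
    then show ?thesis using feasible[OF u] by simp
  next
    case less
    have "a \<le> (V - F u) / (- g u)" if "a \<in> A" for a
    proof -
      have "(F v - V) / g v \<le> (V - F u) / (- g u)" if v: "v \<in> D" "0 < g v" for v
      proof -
        \<comment> \<open>\<open>b\<close> is the weight at which the combination of
          \<open>g u < 0\<close> and \<open>g v > 0\<close> vanishes, so the mixed point is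
          feasible.\<close>
        define b where "b = g v / (g v - g u)"
        have b: "0 \<le> b" "b \<le> 1" using less v by (auto simp: b_def divide_le_eq)
        have b1: "1 - b = (- g u) / (g v - g u)" using less v by (simp add: b_def field_simps)
        have "g (\<lambda>i. b * u i + (1 - b) * v i) \<le> b * g u + (1 - b) * g v" by (intro g u v b)
        also have "\<dots> = 0" unfolding b1 by (simp add: b_def)
        finally have "F (\<lambda>i. b * u i + (1 - b) * v i) \<le> V" by (intro feasible D u v b)
        then have "b * F u + (1 - b) * F v \<le> V" using F[OF u v(1) b] by linarith
        then have "(g v * F u + (- g u) * F v) / (g v - g u) \<le> V"
          unfolding b1 by (simp add: b_def add_divide_distrib[symmetric] diff_divide_distrib[symmetric])
        then show ?thesis using less v by (simp add: field_simps)
      qed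
      moreover have "0 \<le> (V - F u) / (- g u)"
        using less feasible[OF u] by (intro divide_nonneg_pos) auto
      ultimately show ?thesis using that by (auto simp: A_def)
    qed
    then have "Sup A \<le> (V - F u) / (- g u)" by (intro cSup_least) (auto simp: A_def)
    then show ?thesis using less by (simp add: field_simps)
  qed
  moreover have "0 \<le> Sup A" by (intro cSup_upper bdd) (simp add: A_def)
  moreover have "Sup A \<le> 1" by (intro cSup_least le1) (auto simp: A_def)
  ultimately show ?thesis by blast
qed

text \<open>The constraints are dualised one at a time: the last one over the set \<open>D\<close>
  cut out by the others, after which it is absorbed into the objective. \<open>shrink\<close> yields
  the hypothesis \<open>penalty\<close> of \<open>lagrange_multiplier\<close>, because scaling
  \<open>u\<close> down on \<open>U j\<close> repairs that constraint without harming the others, at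
  a loss no larger than the violation.\<close>

lemma lagrange_multipliers_budget:
  fixes F :: "('i \<Rightarrow> real) \<Rightarrow> real" and U :: "nat \<Rightarrow> 'i set" and \<Gamma> :: "nat \<Rightarrow> real"
  assumes F: "\<And>u v a. (\<forall>i. 0 \<le> u i) \<Longrightarrow> (\<forall>i. 0 \<le> v i) \<Longrightarrow> 0 \<le> a \<Longrightarrow> a \<le> 1 \<Longrightarrow>
      a * F u + (1 - a) * F v \<le> F (\<lambda>i. a * u i + (1 - a) * v i)"
    and shrink: "\<And>u j s. (\<forall>i. 0 \<le> u i) \<Longrightarrow> j < K \<Longrightarrow> 0 \<le> s \<Longrightarrow> s \<le> 1 \<Longrightarrow>
      F u \<le> F (\<lambda>i. if i \<in> U j then s * u i else u i) + (1 - s) * (\<Sum>i\<in>U j. u i)"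
    and \<Gamma>: "\<And>j. j < K \<Longrightarrow> 0 \<le> \<Gamma> j"
    and feasible: "\<And>u. (\<forall>i. 0 \<le> u i) \<Longrightarrow> (\<forall>j<K. (\<Sum>i\<in>U j. u i) \<le> \<Gamma> j) \<Longrightarrow> F u \<le> V"
  shows "\<exists>l :: nat \<Rightarrow> real. (\<forall>j. 0 \<le> l j \<and> l j \<le> 1) \<and>
    (\<forall>u. (\<forall>i. 0 \<le> u i) \<longrightarrow> F u - (\<Sum>j<K. l j * ((\<Sum>i\<in>U j. u i) - \<Gamma> j)) \<le> V)"
  using assms
proof (induction K arbitrary: F)
  case 0
  then show ?case by (intro exI[of _ "\<lambda>_. 0"]) auto
next
  case (Suc m)
  define g where "g = (\<lambda>u. (\<Sum>i\<in>U m. u i) - \<Gamma> m)"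
  define D where "D = {u. (\<forall>i. 0 \<le> u i) \<and> (\<forall>j<m. (\<Sum>i\<in>U j. u i) \<le> \<Gamma> j)}"
  have sum_comb: "(\<Sum>i\<in>B. a * u i + (1 - a) * v i) = a * (\<Sum>i\<in>B. u i) + (1 - a) * (\<Sum>i\<in>B. v i)"
    for B :: "'i set" and a :: real and u v
    by (simp add: sum.distrib sum_distrib_left)
  have g_comb: "g (\<lambda>i. a * u i + (1 - a) * v i) = a * g u + (1 - a) * g v" for a u v
    unfolding g_def sum_comb by (simp add: algebra_simps)
  have sum_shrink: "(\<Sum>i\<in>B. if i \<in> U j then s * u i else u i) \<le> (\<Sum>i\<in>B. u i)"
    if "\<forall>i. 0 \<le> u i" "s \<le> 1" for B j s and u :: "'i \<Rightarrow> real"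
    by (intro sum_mono) (use that in \<open>auto intro: mult_left_le_one_le mult_left_le\<close>,
        metis mult_right_mono mult_1)
  have "\<exists>l. 0 \<le> l \<and> l \<le> 1 \<and> (\<forall>u\<in>D. F u - l * g u \<le> V)"
  proof (rule lagrange_multiplier)
    fix u v :: "'i \<Rightarrow> real" and a :: real
    assume uv: "u \<in> D" "v \<in> D" "0 \<le> a" "a \<le> 1"
    show "(\<lambda>i. a * u i + (1 - a) * v i) \<in> D"
      using uv by (auto simp: D_def sum_comb intro!: add_nonneg_nonneg convex_bound_le)
    show "a * F u + (1 - a) * F v \<le> F (\<lambda>i. a * u i + (1 - a) * v i)"
      using uv by (intro Suc.prems(1)) (auto simp: D_def)
    show "g (\<lambda>i. a * u i + (1 - a) * v i) \<le> a * g u + (1 - a) * g v"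
      by (simp add: g_comb)
  next
    show "F u \<le> V" if "u \<in> D" "g u \<le> 0" for u
      using that by (intro Suc.prems(4)) (auto simp: D_def g_def less_Suc_eq)
  next
    fix u assume u: "u \<in> D" "0 < g u"
    define S where "S = (\<Sum>i\<in>U m. u i)"
    \<comment> \<open>The factor that makes the violated budget tight; the amount removed is then
      exactly \<open>g u\<close>.\<close>
    define s where "s = \<Gamma> m / S"
    have S: "\<Gamma> m < S" "0 \<le> \<Gamma> m" using u Suc.prems(3)[of m] by (auto simp: g_def S_def)
    then have s: "0 \<le> s" "s \<le> 1" "s * S = \<Gamma> m" by (auto simp: s_def)
    let ?u = "\<lambda>i. if i \<in> U m then s * u i else u i"
    have "F ?u \<le> V"
    proof (rule Suc.prems(4))
      show "\<forall>i. 0 \<le> ?u i" using u s by (auto simp: D_def)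
      show "\<forall>j<Suc m. (\<Sum>i\<in>U j. ?u i) \<le> \<Gamma> j"
      proof (intro allI impI)
        fix j assume "j < Suc m"
        then consider "j < m" | "j = m" by linarith
        then show "(\<Sum>i\<in>U j. ?u i) \<le> \<Gamma> j"
        proof cases
          case 1
          then have "(\<Sum>i\<in>U j. u i) \<le> \<Gamma> j" using u by (simp add: D_def)
          moreover have "(\<Sum>i\<in>U j. ?u i) \<le> (\<Sum>i\<in>U j. u i)"
            by (rule sum_shrink) (use u s in \<open>auto simp: D_def\<close>)
          ultimately show ?thesis by linarith
        next
          case 2
          have "(\<Sum>i\<in>U m. ?u i) = s * S" by (simp add: S_def sum_distrib_left)
          then show ?thesis using 2 s by simp
        qed
      qed
    qed
    moreover have "F u \<le> F ?u + (1 - s) * S"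
      unfolding S_def by (rule Suc.prems(2)) (use u s in \<open>auto simp: D_def\<close>)
    moreover have "(1 - s) * S = g u" using s(3) by (simp add: algebra_simps g_def S_def)
    ultimately show "F u \<le> V + g u" by linarith
  qed
  then obtain l where l: "0 \<le> l" "l \<le> 1" "\<And>u. u \<in> D \<Longrightarrow> F u - l * g u \<le> V" by blast
  have "\<exists>l' :: nat \<Rightarrow> real. (\<forall>j. 0 \<le> l' j \<and> l' j \<le> 1) \<and>
    (\<forall>u. (\<forall>i. 0 \<le> u i) \<longrightarrow> (F u - l * g u) - (\<Sum>j<m. l' j * ((\<Sum>i\<in>U j. u i) - \<Gamma> j)) \<le> V)"
  proof (rule Suc.IH)
    fix u v :: "'i \<Rightarrow> real" and a :: real
    assume uv: "\<forall>i. 0 \<le> u i" "\<forall>i. 0 \<le> v i" "0 \<le> a" "a \<le> 1"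
    show "a * (F u - l * g u) + (1 - a) * (F v - l * g v)
      \<le> F (\<lambda>i. a * u i + (1 - a) * v i) - l * g (\<lambda>i. a * u i + (1 - a) * v i)"
      using Suc.prems(1)[OF uv] unfolding g_comb by (simp add: algebra_simps)
  next
    fix u :: "'i \<Rightarrow> real" and j :: nat and s :: real
    assume *: "\<forall>i. 0 \<le> u i" "j < m" "0 \<le> s" "s \<le> 1"
    let ?u = "\<lambda>i. if i \<in> U j then s * u i else u i"
    \<comment> \<open>\<open>shrink\<close> passes on to the objective \<open>F - l * g\<close>:
      shrinking never raises \<open>g\<close>, so the subtracted term can only reduce the
      loss.\<close>
    have "g ?u \<le> g u" using sum_shrink[OF *(1,4)] by (simp add: g_def)
    then have "l * g ?u \<le> l * g u" using l by (simp add: mult_left_mono)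
    then show "F u - l * g u \<le> F ?u - l * g ?u + (1 - s) * (\<Sum>i\<in>U j. u i)"
      using Suc.prems(2)[OF *(1) _ *(3,4), of j] *(2) by linarith
  next
    show "0 \<le> \<Gamma> j" if "j < m" for j using Suc.prems(3) that by simp
    show "F u - l * g u \<le> V" if "\<forall>i. 0 \<le> u i" "\<forall>j<m. (\<Sum>i\<in>U j. u i) \<le> \<Gamma> j" for u
      by (rule l(3)) (use that in \<open>simp add: D_def\<close>)
  qed
  then obtain l' :: "nat \<Rightarrow> real" where l': "\<forall>j. 0 \<le> l' j \<and> l' j \<le> 1"
    "\<And>u. (\<forall>i. 0 \<le> u i) \<Longrightarrow> (F u - l * g u) - (\<Sum>j<m. l' j * ((\<Sum>i\<in>U j. u i) - \<Gamma> j)) \<le> V"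
    by blast
  have "(\<Sum>j<Suc m. (l'(m := l)) j * ((\<Sum>i\<in>U j. u i) - \<Gamma> j)) =
    (\<Sum>j<m. l' j * ((\<Sum>i\<in>U j. u i) - \<Gamma> j)) + l * g u" for u
    by (simp add: g_def)
  then show ?case using l' l(1,2)
    by (intro exI[of _ "l'(m := l)"]) (force simp: algebra_simps)
qed

section \<open>The dual objective of a single part and its rounding\<close>

definition weight :: "nat \<Rightarrow> (nat \<Rightarrow> nat set) \<Rightarrow> (nat \<Rightarrow> real) \<Rightarrow> nat \<Rightarrow> real" where
  "weight K U l i = (\<Sum>j<K. if i \<in> U j then l j else 0)"

text \<open>For \<open>M = 1\<close> this is the concave function of the overview. Multipliers of
  the form \<open>k j / M\<close> give that function as \<open>dual_value M\<close> with the weights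
  of the integers \<open>k j\<close>, divided by \<open>M\<close>.\<close>

definition dual_value :: "real \<Rightarrow> (nat \<Rightarrow> real) \<Rightarrow> (nat \<Rightarrow> real) \<Rightarrow> nat set \<Rightarrow> real \<Rightarrow> real" where
  "dual_value M w c T t = M * t - (\<Sum>i\<in>T. w i * max 0 (t - c i))"

lemma sum_weight:
  assumes "finite A" "\<And>j. j < K \<Longrightarrow> U j \<subseteq> A"
  shows "(\<Sum>j<K. l j * (\<Sum>i\<in>U j. u i)) = (\<Sum>i\<in>A. weight K U l i * u i)"
proof -
  have "(\<Sum>i\<in>A. weight K U l i * u i) = (\<Sum>j<K. \<Sum>i\<in>A. (if i \<in> U j then l j else 0) * u i)"
    unfolding weight_def sum_distrib_right by (rule sum.swap)
  also have "\<dots> = (\<Sum>j<K. l j * (\<Sum>i\<in>U j. u i))"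
  proof (rule sum.cong[OF refl])
    fix j assume "j \<in> {..<K}"
    then have "(\<Sum>i\<in>A. (if i \<in> U j then l j else 0) * u i) = (\<Sum>i\<in>U j. l j * u i)"
      using assms by (intro sum.mono_neutral_cong_right) auto
    then show "(\<Sum>i\<in>A. (if i \<in> U j then l j else 0) * u i) = l j * (\<Sum>i\<in>U j. u i)"
      by (simp add: sum_distrib_left)
  qed
  finally show ?thesis ..
qed

text \<open>Strong duality for a fixed set \<open>Q\<close> of open parts. The price
  \<open>F u\<close> of these parts under deviation \<open>u\<close> is concave, being a sum of
  minima of affine functions. Only an upper bound \<open>V\<close> on the primal values enters, so
  no worst case has to be attained.\<close>

lemma dual_multipliers_exist:
  fixes c :: "nat \<Rightarrow> real"
  assumes Q: "finite Q" "disjoint Q" "\<And>T. T \<in> Q \<Longrightarrow> finite T \<and> T \<noteq> {}"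
    and U: "finite A" "\<And>j. j < K \<Longrightarrow> U j \<subseteq> A" and OA: "\<Union>Q \<subseteq> A"
    and \<Gamma>: "\<And>j. j < K \<Longrightarrow> 0 \<le> \<Gamma> j"
    and primal: "\<And>u. (\<forall>i. 0 \<le> u i) \<Longrightarrow> (\<forall>j<K. (\<Sum>i\<in>U j. u i) \<le> \<Gamma> j) \<Longrightarrow>
      (\<Sum>T\<in>Q. Min ((\<lambda>i. c i + u i) ` T)) \<le> V"
  shows "\<exists>l :: nat \<Rightarrow> real. (\<forall>j. 0 \<le> l j \<and> l j \<le> 1) \<and>
    (\<forall>t. (\<Sum>j<K. \<Gamma> j * l j) + (\<Sum>T\<in>Q. dual_value 1 (weight K U l) c T (t T)) \<le> V)"
proof -
  define F where "F = (\<lambda>u :: nat \<Rightarrow> real. \<Sum>T\<in>Q. Min ((\<lambda>i. c i + u i) ` T))"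
  have "\<exists>l :: nat \<Rightarrow> real. (\<forall>j. 0 \<le> l j \<and> l j \<le> 1) \<and>
    (\<forall>u. (\<forall>i. 0 \<le> u i) \<longrightarrow> F u - (\<Sum>j<K. l j * ((\<Sum>i\<in>U j. u i) - \<Gamma> j)) \<le> V)"
  proof (rule lagrange_multipliers_budget)
    fix u v :: "nat \<Rightarrow> real" and a :: real
    assume uv: "\<forall>i. 0 \<le> u i" "\<forall>i. 0 \<le> v i" "0 \<le> a" "a \<le> 1"
    show "a * F u + (1 - a) * F v \<le> F (\<lambda>i. a * u i + (1 - a) * v i)"
      unfolding F_def sum_distrib_left sum.distrib[symmetric]
    proof (rule sum_mono)
      fix T assume "T \<in> Q"
      then have T: "finite T" "T \<noteq> {}" using Q by auto
      show "a * Min ((\<lambda>i. c i + u i) ` T) + (1 - a) * Min ((\<lambda>i. c i + v i) ` T)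
        \<le> Min ((\<lambda>i. c i + (a * u i + (1 - a) * v i)) ` T)"
      proof (rule Min.boundedI)
        fix y assume "y \<in> (\<lambda>i. c i + (a * u i + (1 - a) * v i)) ` T"
        then obtain i where i: "i \<in> T" "y = a * (c i + u i) + (1 - a) * (c i + v i)"
          by (auto simp: algebra_simps)
        show "a * Min ((\<lambda>i. c i + u i) ` T) + (1 - a) * Min ((\<lambda>i. c i + v i) ` T) \<le> y"
          unfolding i(2) using uv i(1) T by (intro add_mono mult_left_mono Min_le) auto
      qed (use T in auto)
    qed
  next
    fix u :: "nat \<Rightarrow> real" and j :: nat and s :: real
    assume *: "\<forall>i. 0 \<le> u i" "j < K" "0 \<le> s" "s \<le> 1"
    let ?u = "\<lambda>i. if i \<in> U j then s * u i else u i"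
    let ?d = "\<lambda>i. if i \<in> U j then (1 - s) * u i else 0"
    have d: "0 \<le> ?d i" for i using * by simp
    have "F u \<le> (\<Sum>T\<in>Q. Min ((\<lambda>i. c i + ?u i) ` T) + (\<Sum>i\<in>T. ?d i))"
      unfolding F_def
    proof (rule sum_mono)
      fix T assume "T \<in> Q"
      then have T: "finite T" "T \<noteq> {}" using Q by auto
      then have "Min ((\<lambda>i. c i + ?u i) ` T) \<in> (\<lambda>i. c i + ?u i) ` T" by (intro Min_in) auto
      then obtain i where i: "i \<in> T" "Min ((\<lambda>i. c i + ?u i) ` T) = c i + ?u i" by blast
      \<comment> \<open>The element \<open>i\<close> that is cheapest after shrinking has lost only
        \<open>?d i\<close>, so the minimum fell by at most the total removed from \<open>T\<close>.
        Disjointness of the parts then prevents double counting.\<close>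
      have "Min ((\<lambda>i. c i + u i) ` T) \<le> c i + u i" using T i by (intro Min_le) auto
      also have "\<dots> = (c i + ?u i) + ?d i" by (simp add: algebra_simps)
      also have "?d i \<le> (\<Sum>i\<in>T. ?d i)" using T i d by (intro member_le_sum) auto
      finally show "Min ((\<lambda>i. c i + u i) ` T) \<le> Min ((\<lambda>i. c i + ?u i) ` T) + (\<Sum>i\<in>T. ?d i)"
        using i by simp
    qed
    also have "\<dots> = F ?u + (\<Sum>T\<in>Q. \<Sum>i\<in>T. ?d i)"
      by (simp add: F_def sum.distrib)
    also have "(\<Sum>T\<in>Q. \<Sum>i\<in>T. ?d i) = (\<Sum>i\<in>\<Union>Q. ?d i)"
      using Q by (subst sum.Union_disjoint) (auto simp: disjoint_def)
    also have "\<dots> \<le> (\<Sum>i\<in>A. ?d i)"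
      using U OA d by (intro sum_mono2) auto
    also have "\<dots> = (\<Sum>i\<in>U j. (1 - s) * u i)"
      using U *(2) by (intro sum.mono_neutral_cong_right) auto
    finally show "F u \<le> F ?u + (1 - s) * (\<Sum>i\<in>U j. u i)" by (simp add: sum_distrib_left)
  next
    show "0 \<le> \<Gamma> j" if "j < K" for j using \<Gamma> that .
    show "F u \<le> V" if "\<forall>i. 0 \<le> u i" "\<forall>j<K. (\<Sum>i\<in>U j. u i) \<le> \<Gamma> j" for u
      unfolding F_def by (rule primal) (use that in auto)
  qed
  then obtain l :: "nat \<Rightarrow> real" where l: "\<forall>j. 0 \<le> l j \<and> l j \<le> 1"
    "\<And>u. (\<forall>i. 0 \<le> u i) \<Longrightarrow> F u - (\<Sum>j<K. l j * ((\<Sum>i\<in>U j. u i) - \<Gamma> j)) \<le> V"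
    by blast
  have "(\<Sum>j<K. \<Gamma> j * l j) + (\<Sum>T\<in>Q. dual_value 1 (weight K U l) c T (t T)) \<le> V" for t
  proof -
    \<comment> \<open>The least deviation that lifts every element of \<open>T\<close> to a price of
      at least \<open>t T\<close>, for all open parts at once.\<close>
    define u where "u = (\<lambda>i. \<Sum>T\<in>Q. if i \<in> T then max 0 (t T - c i) else 0)"
    have u_in: "u i = max 0 (t T - c i)" if "T \<in> Q" "i \<in> T" for i T
    proof -
      have "u i = (\<Sum>S\<in>{T}. max 0 (t S - c i))"
        unfolding u_def using Q that by (intro sum.mono_neutral_cong_right) (auto simp: disjoint_def)
      then show ?thesis by simp
    qed
    have u_out: "u i = 0" if "i \<notin> \<Union>Q" for i
      using that unfolding u_def by (intro sum.neutral) auto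
    have "\<forall>i. 0 \<le> u i" unfolding u_def by (auto intro!: sum_nonneg)
    then have "F u - (\<Sum>j<K. l j * ((\<Sum>i\<in>U j. u i) - \<Gamma> j)) \<le> V" by (rule l(2))
    moreover have "(\<Sum>T\<in>Q. t T) \<le> F u"
      unfolding F_def
    proof (rule sum_mono)
      fix T assume T: "T \<in> Q"
      then have "finite T" "T \<noteq> {}" using Q by auto
      then show "t T \<le> Min ((\<lambda>i. c i + u i) ` T)"
        by (subst Min_ge_iff) (auto simp: u_in[OF T])
    qed
    moreover have "(\<Sum>j<K. l j * (\<Sum>i\<in>U j. u i)) = (\<Sum>T\<in>Q. \<Sum>i\<in>T. weight K U l i * max 0 (t T - c i))"
    proof -
      have "(\<Sum>j<K. l j * (\<Sum>i\<in>U j. u i)) = (\<Sum>i\<in>A. weight K U l i * u i)"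
        by (rule sum_weight[OF U])
      also have "\<dots> = (\<Sum>i\<in>\<Union>Q. weight K U l i * u i)"
        using U OA u_out by (intro sum.mono_neutral_right) auto
      also have "\<dots> = (\<Sum>T\<in>Q. \<Sum>i\<in>T. weight K U l i * u i)"
        using Q by (subst sum.Union_disjoint) (auto simp: disjoint_def)
      finally show ?thesis by (simp add: u_in)
    qed
    ultimately show ?thesis
      by (simp add: dual_value_def sum_subtractf right_diff_distrib mult.commute)
  qed
  then show ?thesis using l(1) by blast
qed

text \<open>\<open>dual_value\<close> is concave and piecewise linear in \<open>t\<close> with breakpoints \<open>c i\<close>, and its
  last slope is at most 0.\<close>

lemma dual_value_le_breakpoint:
  fixes c w :: "nat \<Rightarrow> real"
  assumes T: "finite T" "T \<noteq> {}" and w: "\<And>i. i \<in> T \<Longrightarrow> 0 \<le> w i"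
    and M: "0 \<le> M" "M \<le> (\<Sum>i\<in>T. w i)"
  shows "\<exists>i\<in>T. dual_value M w c T t \<le> dual_value M w c T (c i)"
proof -
  define L where "L = {i \<in> T. c i \<le> t}"
  have sum_L: "(\<Sum>i\<in>T. w i * max 0 (r - c i)) = (\<Sum>i\<in>L. w i * (r - c i))"
    if "\<And>i. i \<in> L \<Longrightarrow> c i \<le> r" "\<And>i. i \<in> T - L \<Longrightarrow> r \<le> c i" for r
    using T that by (intro sum.mono_neutral_cong_right) (auto simp: L_def)
  have dual: "dual_value M w c T r = M * r - (\<Sum>i\<in>L. w i) * r + (\<Sum>i\<in>L. w i * c i)"
    if "\<And>i. i \<in> L \<Longrightarrow> c i \<le> r" "\<And>i. i \<in> T - L \<Longrightarrow> r \<le> c i" for r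
  proof -
    have "(\<Sum>i\<in>T. w i * max 0 (r - c i)) = (\<Sum>i\<in>L. w i * (r - c i))"
      by (rule sum_L) (use that in auto)
    then show ?thesis
      by (simp add: dual_value_def right_diff_distrib sum_subtractf sum_distrib_right)
  qed
  have t: "dual_value M w c T t = M * t - (\<Sum>i\<in>L. w i) * t + (\<Sum>i\<in>L. w i * c i)"
    by (rule dual) (auto simp: L_def)
  show ?thesis
  \<comment> \<open>Around \<open>t\<close> the slope is \<open>M\<close> minus the weights of
    \<open>L\<close>. If it is at most 0, moving left to the last breakpoint of \<open>L\<close>
    does not lower the value; otherwise, or if \<open>L\<close> is empty, moving right to the next
    breakpoint does not.\<close>
  proof (cases "L \<noteq> {} \<and> M \<le> (\<Sum>i\<in>L. w i)")
    case True
    have "finite L" using T by (simp add: L_def)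
    then have "Max (c ` L) \<in> c ` L" using True by (intro Max_in) auto
    then obtain a where a: "a \<in> L" "c a = Max (c ` L)" by (metis imageE)
    have "dual_value M w c T (c a) = M * c a - (\<Sum>i\<in>L. w i) * c a + (\<Sum>i\<in>L. w i * c i)"
      by (rule dual) (use a \<open>finite L\<close> in \<open>auto simp: L_def\<close>)
    moreover have "0 \<le> ((\<Sum>i\<in>L. w i) - M) * (t - c a)"
      using True a by (intro mult_nonneg_nonneg) (auto simp: L_def)
    ultimately show ?thesis unfolding t
      using a by (intro bexI[of _ a]) (auto simp: L_def algebra_simps)
  next
    case False
    have "T - L \<noteq> {}"
    proof
      assume "T - L = {}"
      then have "L = T" by (auto simp: L_def)
      then show False using False M T by simp
    qed
    moreover have "finite (T - L)" using T by simp
    ultimately have "Min (c ` (T - L)) \<in> c ` (T - L)" by (intro Min_in) auto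
    then obtain b where b: "b \<in> T - L" "c b = Min (c ` (T - L))" by (metis imageE)
    have "dual_value M w c T (c b) = M * c b - (\<Sum>i\<in>L. w i) * c b + (\<Sum>i\<in>L. w i * c i)"
      by (rule dual) (use b \<open>finite (T - L)\<close> in \<open>auto simp: L_def\<close>)
    moreover have "(\<Sum>i\<in>L. w i) \<le> M" using False M by force
    then have "0 \<le> (M - (\<Sum>i\<in>L. w i)) * (c b - t)"
      using b by (intro mult_nonneg_nonneg) (auto simp: L_def)
    ultimately show ?thesis unfolding t
      using b by (intro bexI[of _ b]) (auto simp: algebra_simps)
  qed
qed

text \<open>Each of the \<open>K\<close> floors loses less than 1.\<close>

lemma weight_floor:
  assumes "\<And>j. 0 \<le> l j"
  shows "real_of_int N * weight K U l i - real K \<le> weight K U (\<lambda>j. real_of_int \<lfloor>N * l j\<rfloor>) i"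
proof -
  have "real_of_int N * weight K U l i - real K = (\<Sum>j<K. (if i \<in> U j then N * l j else 0) - 1)"
    by (simp add: weight_def sum_distrib_left sum_subtractf
        if_distrib[of "(*) (real_of_int N)"] cong: if_cong)
  also have "\<dots> \<le> weight K U (\<lambda>j. real_of_int \<lfloor>N * l j\<rfloor>) i"
    unfolding weight_def
  proof (rule sum_mono)
    show "(if i \<in> U j then N * l j else 0) - 1 \<le> (if i \<in> U j then real_of_int \<lfloor>N * l j\<rfloor> else 0)" for j
      using floor_correct[of "N * l j"] by auto
  qed
  finally show ?thesis .
qed

text \<open>Rounding lowers each scaled weight by at most \<open>K\<close>, and its factor
  \<open>max 0 (t - c i)\<close> is at most \<open>t\<close>. The total effect of
  \<open>card T * K * t\<close> is offset by lowering the coefficient of \<open>t\<close> from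
  \<open>N\<close> to \<open>M\<close>; hence the required gap between the two.\<close>

lemma dual_value_floor:
  assumes "\<And>j. 0 \<le> l j" "\<And>i. 0 \<le> c i" "0 \<le> t" "real (card T * K) \<le> N - M"
  shows "dual_value M (weight K U (\<lambda>j. real_of_int \<lfloor>N * l j\<rfloor>)) c T t
    \<le> real_of_int N * dual_value 1 (weight K U l) c T t"
proof -
  let ?k = "\<lambda>j. real_of_int \<lfloor>N * l j\<rfloor>"
  have "(\<Sum>i\<in>T. real_of_int N * weight K U l i * max 0 (t - c i) - K * t)
    \<le> (\<Sum>i\<in>T. weight K U ?k i * max 0 (t - c i))"
  proof (rule sum_mono)
    fix i
    have "(real_of_int N * weight K U l i - real K) * max 0 (t - c i)
        \<le> weight K U ?k i * max 0 (t - c i)"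
      by (intro mult_right_mono weight_floor assms) auto
    moreover have "real K * max 0 (t - c i) \<le> real K * t"
      using assms(2)[of i] assms(3) by (intro mult_left_mono) auto
    ultimately show "real_of_int N * weight K U l i * max 0 (t - c i) - K * t
        \<le> weight K U ?k i * max 0 (t - c i)"
      by (simp add: algebra_simps)
  qed
  moreover have "real (card T * K) * t \<le> (N - M) * t"
    using assms(3,4) by (rule mult_right_mono[rotated])
  ultimately show ?thesis
    by (simp add: dual_value_def sum_subtractf algebra_simps sum_distrib_left)
qed

section \<open>The robust problem\<close>

locale two_stage_RS =
  fixes n K :: nat and Ts Us :: "nat set list" and C c \<Gamma> :: "real vec"
  assumes partition: "partition_on {..<n} (set Ts)"
    and C: "C \<in> carrier_vec n" "\<And>i. i < n \<Longrightarrow> 0 \<le> C $ i"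
    and c: "c \<in> carrier_vec n" "\<And>i. i < n \<Longrightarrow> 0 \<le> c $ i"
    and Us: "length Us = K" "\<And>j. j < K \<Longrightarrow> Us ! j \<subseteq> {..<n}"
    and \<Gamma>: "\<And>j. j < K \<Longrightarrow> 0 \<le> \<Gamma> $ j"
begin

abbreviation X :: "real vec set" where "X \<equiv> RS_set n Ts"

abbreviation cost :: "real vec \<Rightarrow> ereal" where
  "cost \<equiv> two_stage_cost n X C (U_HP1 n c Us \<Gamma>)"

abbreviation wt :: "(nat \<Rightarrow> real) \<Rightarrow> nat \<Rightarrow> real" where
  "wt \<equiv> weight K (\<lambda>j. Us ! j)"

definition selection :: "(nat set \<Rightarrow> nat) \<Rightarrow> nat set set \<Rightarrow> real vec" where
  "selection g Q = vec n (\<lambda>i. if i \<in> g ` Q then 1 else 0)"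

lemma part_subset: "T \<in> set Ts \<Longrightarrow> T \<subseteq> {..<n}"
  and part_nonempty: "T \<in> set Ts \<Longrightarrow> T \<noteq> {}"
  and part_Union: "\<Union>(set Ts) = {..<n}"
  and part_disjoint: "disjoint (set Ts)"
  using partition by (auto simp: partition_on_def)

lemma part_finite: "T \<in> set Ts \<Longrightarrow> finite T"
  using part_subset finite_subset by blast

lemma part_unique: "T \<in> set Ts \<Longrightarrow> T' \<in> set Ts \<Longrightarrow> i \<in> T \<Longrightarrow> i \<in> T' \<Longrightarrow> T = T'"
  using part_disjoint by (auto simp: disjoint_def)

lemma sum_parts: "(\<Sum>i<n. f i) = (\<Sum>T\<in>set Ts. \<Sum>i\<in>T. f i)" for f :: "nat \<Rightarrow> real"
  unfolding part_Union[symmetric]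
  by (subst sum.Union_disjoint) (auto simp: part_finite dest: part_unique)

lemma selection_carrier [simp]: "selection g Q \<in> carrier_vec n" "dim_vec (selection g Q) = n"
  by (simp_all add: selection_def)

lemma selection_index: "i < n \<Longrightarrow> selection g Q $ i = (if i \<in> g ` Q then 1 else 0)"
  by (simp add: selection_def)

lemma selection_binary: "selection g Q \<in> binary_vecs n"
  by (auto simp: binary_vecs_def selection_index)

lemma mem_choice_iff:
  assumes "Q \<subseteq> set Ts" "\<And>T. T \<in> Q \<Longrightarrow> g T \<in> T" "T \<in> set Ts" "i \<in> T"
  shows "i \<in> g ` Q \<longleftrightarrow> T \<in> Q \<and> i = g T"
proof
  assume "i \<in> g ` Q"
  then obtain S where S: "S \<in> Q" "i = g S" by blast
  then have "S = T" using assms by (intro part_unique[of S T i]) auto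
  then show "T \<in> Q \<and> i = g T" using S by simp
qed auto

lemma choice_inj:
  assumes "Q \<subseteq> set Ts" "\<And>T. T \<in> Q \<Longrightarrow> g T \<in> T"
  shows "inj_on g Q"
  using assms by (intro inj_onI) (metis part_unique subsetD)

lemma scalar_prod_selection:
  assumes "Q \<subseteq> set Ts" "\<And>T. T \<in> Q \<Longrightarrow> g T \<in> T"
  shows "v \<bullet> selection g Q = (\<Sum>T\<in>Q. v $ g T)"
proof -
  have "g T < n" if "T \<in> Q" for T using that assms part_subset by blast
  then have "v \<bullet> selection g Q = (\<Sum>i\<in>g ` Q. v $ i)"
    unfolding scalar_prod_def
    by (intro sum.mono_neutral_cong_right) (auto simp: selection_index)
  then show ?thesis by (simp add: sum.reindex[OF choice_inj[OF assms]])
qed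

lemma selection_recourse:
  assumes "Q \<subseteq> set Ts" "\<And>T. T \<in> Q \<Longrightarrow> g T \<in> T" "\<And>T. T \<in> set Ts - Q \<Longrightarrow> h T \<in> T"
  shows "selection h (set Ts - Q) \<in> recourse n X (selection g Q)"
proof -
  have val: "(selection g Q + selection h (set Ts - Q)) $ i
      = (if i = (if T \<in> Q then g T else h T) then 1 else 0)" if "T \<in> set Ts" "i \<in> T" for T i
  proof -
    have "i < n" using that part_subset by blast
    moreover have "i \<in> g ` Q \<longleftrightarrow> T \<in> Q \<and> i = g T"
      by (rule mem_choice_iff[OF assms(1,2) that])
    moreover have "i \<in> h ` (set Ts - Q) \<longleftrightarrow> T \<in> set Ts - Q \<and> i = h T"
      by (rule mem_choice_iff[OF _ assms(3) that]) auto
    ultimately show ?thesis using that by (auto simp: selection_index)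
  qed
  have "selection g Q + selection h (set Ts - Q) \<in> X"
    unfolding RS_set_def binary_vecs_def
  proof (intro CollectI conjI allI impI)
    show "selection g Q + selection h (set Ts - Q) \<in> carrier_vec n" by simp
    show "(selection g Q + selection h (set Ts - Q)) $ i \<in> {0, 1}" if "i < n" for i
    proof -
      obtain T where "T \<in> set Ts" "i \<in> T" using \<open>i < n\<close> part_Union by blast
      then show ?thesis using val by auto
    qed
    show "(\<Sum>i\<in>Ts ! l. (selection g Q + selection h (set Ts - Q)) $ i) = 1" if "l < length Ts" for l
    proof -
      have T: "Ts ! l \<in> set Ts" using that by simp
      moreover from this have "(if Ts ! l \<in> Q then g (Ts ! l) else h (Ts ! l)) \<in> Ts ! l"
        using assms by auto
      ultimately show ?thesis using part_finite[OF T] by (simp add: val sum.delta)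
    qed
  qed
  then show ?thesis by (simp add: recourse_def selection_binary)
qed

lemma sum_wt: "(\<Sum>j<K. l j * (\<Sum>i\<in>Us ! j. u i)) = (\<Sum>i<n. wt l i * u i)"
  using Us by (intro sum_weight) auto

text \<open>Weak duality: any multipliers that reach \<open>M\<close> on every open part certify a
  bound on the worst case. The recourse takes the cheapest element of each open part, and the
  adversary has to pay for its price out of the budgets.\<close>

lemma cost_selection_le:
  assumes Q: "Q \<subseteq> set Ts" "\<And>T. T \<in> Q \<Longrightarrow> g T \<in> T" and k: "\<And>j. 0 \<le> k j" and M: "0 < M"
    and feasible: "\<And>T. T \<in> set Ts - Q \<Longrightarrow> M \<le> (\<Sum>i\<in>T. wt k i)"
    and F: "\<And>T i. T \<in> set Ts - Q \<Longrightarrow> i \<in> T \<Longrightarrow> dual_value M (wt k) (($) c) T (c $ i) \<le> F T"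
  shows "cost (selection g Q)
    \<le> ereal (((\<Sum>j<K. \<Gamma> $ j * k j) + (\<Sum>T\<in>Q. M * C $ g T) + (\<Sum>T\<in>set Ts - Q. F T)) / M)"
    (is "_ \<le> ereal (?B / M)")
  unfolding two_stage_cost_def
proof (rule SUP_least)
  fix d assume "d \<in> U_HP1 n c Us \<Gamma>"
  then obtain \<delta> where \<delta>: "d = c + \<delta>" "\<delta> \<in> carrier_vec n" "\<And>i. i < n \<Longrightarrow> 0 \<le> \<delta> $ i"
    "\<And>j. j < K \<Longrightarrow> (\<Sum>i\<in>Us ! j. \<delta> $ i) \<le> \<Gamma> $ j"
    unfolding U_HP1_def using Us by auto
  have wt_nonneg: "0 \<le> wt k i" for i unfolding weight_def by (intro sum_nonneg) (simp add: k)
  define h where "h = (\<lambda>T. arg_min_on (\<lambda>i. d $ i) T)"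
  have h: "h T \<in> T" "\<And>i. i \<in> T \<Longrightarrow> d $ h T \<le> d $ i" if "T \<in> set Ts" for T
    unfolding h_def using that part_finite part_nonempty
    by (auto intro: arg_min_if_finite(1) arg_min_least)
  have d: "d $ i = c $ i + \<delta> $ i" if "i < n" for i using that \<delta> c by simp
  \<comment> \<open>Since \<open>d $ h T\<close> is the minimum over \<open>T\<close>,
    \<open>\<delta> $ i\<close> is at least \<open>max 0 (d $ h T - c $ i)\<close> for every
    \<open>i\<close> in \<open>T\<close>. The dual value at that price is dominated by a breakpoint,
    hence by \<open>F T\<close>.\<close>
  have part: "M * d $ h T \<le> F T + (\<Sum>i\<in>T. wt k i * \<delta> $ i)" if T: "T \<in> set Ts - Q" for T
  proof -
    have fin: "finite T" "T \<noteq> {}" "T \<subseteq> {..<n}"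
      using T part_finite part_nonempty part_subset by auto
    obtain i where i: "i \<in> T" "dual_value M (wt k) (($) c) T (d $ h T)
        \<le> dual_value M (wt k) (($) c) T (c $ i)"
      using dual_value_le_breakpoint[of T "wt k" M "($) c" "d $ h T"] fin wt_nonneg M feasible[OF T]
      by auto
    then have "dual_value M (wt k) (($) c) T (d $ h T) \<le> F T"
      using F[OF T] by fastforce
    moreover have "(\<Sum>i\<in>T. wt k i * max 0 (d $ h T - c $ i)) \<le> (\<Sum>i\<in>T. wt k i * \<delta> $ i)"
    proof (rule sum_mono)
      fix i assume i: "i \<in> T"
      then have "i < n" using fin by auto
      then show "wt k i * max 0 (d $ h T - c $ i) \<le> wt k i * \<delta> $ i"
        using h(2)[of T i] T i d[of i] \<delta>(3)[of i] by (intro mult_left_mono wt_nonneg) auto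
    qed
    ultimately show ?thesis by (simp add: dual_value_def)
  qed
  have "(\<Sum>T\<in>set Ts - Q. \<Sum>i\<in>T. wt k i * \<delta> $ i) \<le> (\<Sum>T\<in>set Ts. \<Sum>i\<in>T. wt k i * \<delta> $ i)"
    using \<delta>(3) part_subset wt_nonneg
    by (intro sum_mono2) (auto intro!: sum_nonneg mult_nonneg_nonneg)
  also have "\<dots> = (\<Sum>j<K. k j * (\<Sum>i\<in>Us ! j. \<delta> $ i))"
    by (simp add: sum_parts[symmetric] sum_wt)
  also have "\<dots> \<le> (\<Sum>j<K. \<Gamma> $ j * k j)"
    using \<delta>(4) k by (intro sum_mono) (simp add: mult.commute mult_left_mono)
  finally have budget: "(\<Sum>T\<in>set Ts - Q. \<Sum>i\<in>T. wt k i * \<delta> $ i) \<le> (\<Sum>j<K. \<Gamma> $ j * k j)" .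
  have "(INF y\<in>recourse n X (selection g Q). ereal (C \<bullet> selection g Q + d \<bullet> y))
    \<le> ereal (C \<bullet> selection g Q + d \<bullet> selection h (set Ts - Q))"
    using Q h by (intro INF_lower selection_recourse) auto
  also have "C \<bullet> selection g Q + d \<bullet> selection h (set Ts - Q)
      = (\<Sum>T\<in>Q. C $ g T) + (\<Sum>T\<in>set Ts - Q. d $ h T)"
    using Q h by (subst (1 2) scalar_prod_selection) auto
  also have "\<dots> \<le> ?B / M"
  proof -
    have "(\<Sum>T\<in>set Ts - Q. M * d $ h T) \<le> (\<Sum>T\<in>set Ts - Q. F T + (\<Sum>i\<in>T. wt k i * \<delta> $ i))"
      by (intro sum_mono part)
    then have "M * ((\<Sum>T\<in>Q. C $ g T) + (\<Sum>T\<in>set Ts - Q. d $ h T)) \<le> ?B"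
      using budget by (simp add: distrib_left sum_distrib_left sum.distrib)
    then show ?thesis using M by (simp add: pos_le_divide_eq mult.commute)
  qed
  finally show "(INF y\<in>recourse n X (selection g Q). ereal (C \<bullet> selection g Q + d \<bullet> y))
    \<le> ereal (?B / M)"
    by simp
qed

lemma selection_first_stage:
  assumes "Q \<subseteq> set Ts" "\<And>T. T \<in> Q \<Longrightarrow> g T \<in> T"
  shows "selection g Q \<in> first_stage n X"
proof -
  have "selection (\<lambda>T. SOME i. i \<in> T) (set Ts - Q) \<in> recourse n X (selection g Q)"
    using assms part_nonempty by (intro selection_recourse) (auto simp: some_in_eq)
  then show ?thesis by (auto simp: first_stage_def selection_binary)
qed

text \<open>The zero deviation meets all budgets, so the supremum ranges over a nonempty set and
  cannot be minus infinity. Nonnegativity also allows replacing the factor \<open>N / M\<close> by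
  the larger 1 + eps.\<close>

lemma cost_nonneg:
  assumes "x \<in> first_stage n X"
  shows "0 \<le> cost x"
proof -
  have "c + 0\<^sub>v n \<in> U_HP1 n c Us \<Gamma>"
    unfolding U_HP1_def using Us \<Gamma> by (intro CollectI exI[of _ "0\<^sub>v n"]) (auto simp: subset_eq)
  then have "c \<in> U_HP1 n c Us \<Gamma>" using c by simp
  moreover have "0 \<le> (INF y\<in>recourse n X x. ereal (C \<bullet> x + c \<bullet> y))"
  proof (rule INF_greatest)
    fix y assume "y \<in> recourse n X x"
    then have "y \<in> binary_vecs n" "x \<in> binary_vecs n"
      using assms by (auto simp: recourse_def first_stage_def)
    then show "0 \<le> ereal (C \<bullet> x + c \<bullet> y)"
      using C c unfolding scalar_prod_def binary_vecs_def
      by (auto intro!: add_nonneg_nonneg sum_nonneg mult_nonneg_nonneg)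
  qed
  ultimately show ?thesis unfolding two_stage_cost_def by (meson SUP_upper2)
qed

text \<open>The open parts \<open>Q\<close> are read off from \<open>x\<close>. The bound is stated
  for all \<open>t\<close> and \<open>m\<close>, because the algorithm evaluates it at its own
  breakpoints and cheapest costs.\<close>

lemma rounded_multipliers_exist:
  fixes M V :: real and N :: int
  assumes x: "x \<in> first_stage n X" and V: "cost x \<le> ereal V"
    and M: "0 < M" and N: "M + real (n * K) \<le> N"
  shows "\<exists>Q\<subseteq>set Ts. \<exists>k :: nat \<Rightarrow> int. (\<forall>j. 0 \<le> k j \<and> k j \<le> N) \<and>
    (\<forall>T\<in>Q. M \<le> (\<Sum>i\<in>T. wt (\<lambda>j. k j) i)) \<and>
    (\<forall>t m. (\<forall>T\<in>Q. 0 \<le> t T) \<longrightarrow> (\<forall>T\<in>set Ts. 0 \<le> m T \<and> (\<forall>i\<in>T. m T \<le> C $ i)) \<longrightarrow>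
      (\<Sum>j<K. \<Gamma> $ j * k j) + (\<Sum>T\<in>Q. dual_value M (wt (\<lambda>j. k j)) (($) c) T (t T))
        + (\<Sum>T\<in>set Ts - Q. M * m T) \<le> N * V)"
proof -
  have xb: "x \<in> binary_vecs n" using x by (simp add: first_stage_def)
  define Q where "Q = {T \<in> set Ts. \<forall>i\<in>T. x $ i = 0}"
  \<comment> \<open>Entries beyond the dimension of a vector are unspecified; setting them to 0
    gives the nonnegativity at all indices that \<open>dual_value_floor\<close> asks for.\<close>
  define c' where "c' = (\<lambda>i. if i < n then c $ i else 0)"
  have c': "0 \<le> c' i" for i using c by (simp add: c'_def)
  have Q: "Q \<subseteq> set Ts" "finite Q" "disjoint Q" "\<And>T. T \<in> Q \<Longrightarrow> finite T \<and> T \<noteq> {}"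
    using part_finite part_nonempty part_disjoint by (auto simp: Q_def disjoint_def)
  have "\<exists>l :: nat \<Rightarrow> real. (\<forall>j. 0 \<le> l j \<and> l j \<le> 1) \<and>
    (\<forall>t. (\<Sum>j<K. \<Gamma> $ j * l j) + (\<Sum>T\<in>Q. dual_value 1 (wt l) c' T (t T)) \<le> V - C \<bullet> x)"
  proof (rule dual_multipliers_exist[where A = "{..<n}"])
    show "\<Union>Q \<subseteq> {..<n}" using Q(1) part_subset by blast
    fix u :: "nat \<Rightarrow> real"
    assume u: "\<forall>i. 0 \<le> u i" "\<forall>j<K. (\<Sum>i\<in>Us ! j. u i) \<le> \<Gamma> $ j"
    let ?d = "c + vec n u"
    have "(\<Sum>i\<in>Us ! j. vec n u $ i) = (\<Sum>i\<in>Us ! j. u i)" if "j < K" for j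
      using Us(2)[OF that] by (intro sum.cong) auto
    then have d: "?d \<in> U_HP1 n c Us \<Gamma>"
      unfolding U_HP1_def using u Us(1) by (intro CollectI exI[of _ "vec n u"]) auto
    have "ereal (C \<bullet> x + (\<Sum>T\<in>Q. Min ((\<lambda>i. c' i + u i) ` T)))
        \<le> (INF y\<in>recourse n X x. ereal (C \<bullet> x + ?d \<bullet> y))"
    proof (rule INF_greatest)
      fix y assume "y \<in> recourse n X x"
      then have y: "y \<in> binary_vecs n" "x + y \<in> X" by (auto simp: recourse_def)
      then have dim: "dim_vec y = n" by (simp add: binary_vecs_def)
      have y0: "0 \<le> y $ i" if "i < n" for i
        using y(1) that by (auto simp: binary_vecs_def)
      have d0: "?d $ i = c' i + u i" "0 \<le> c' i + u i" if "i < n" for i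
        using that c u by (auto simp: c'_def)
      have "(\<Sum>T\<in>Q. Min ((\<lambda>i. c' i + u i) ` T)) \<le> (\<Sum>T\<in>Q. \<Sum>i\<in>T. ?d $ i * y $ i)"
      proof (rule sum_mono)
        fix T assume T: "T \<in> Q"
        then obtain l where l: "l < length Ts" "Ts ! l = T"
          using Q(1) by (metis in_set_conv_nth subsetD)
        have sub: "T \<subseteq> {..<n}" using T Q(1) part_subset by blast
        \<comment> \<open>On an open part \<open>x\<close> vanishes, so \<open>y\<close> alone sums
          to 1 there and pays at least the minimum.\<close>
        have "(\<Sum>i\<in>T. (x + y) $ i) = 1" using y(2) l unfolding RS_set_def by auto
        moreover have "(\<Sum>i\<in>T. (x + y) $ i) = (\<Sum>i\<in>T. y $ i)"
          using T sub dim by (intro sum.cong) (auto simp: Q_def)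
        ultimately have "Min ((\<lambda>i. c' i + u i) ` T) = (\<Sum>i\<in>T. Min ((\<lambda>i. c' i + u i) ` T) * y $ i)"
          by (simp add: sum_distrib_left[symmetric])
        also have "\<dots> \<le> (\<Sum>i\<in>T. ?d $ i * y $ i)"
        proof (rule sum_mono)
          fix i assume i: "i \<in> T"
          then have "i < n" using sub by auto
          moreover have "Min ((\<lambda>i. c' i + u i) ` T) \<le> c' i + u i"
            using Q(4)[OF T] i by (intro Min_le) auto
          ultimately show "Min ((\<lambda>i. c' i + u i) ` T) * y $ i \<le> ?d $ i * y $ i"
            using y0 d0 by (intro mult_right_mono) auto
        qed
        finally show "Min ((\<lambda>i. c' i + u i) ` T) \<le> (\<Sum>i\<in>T. ?d $ i * y $ i)" .
      qed
      also have "\<dots> \<le> (\<Sum>T\<in>set Ts. \<Sum>i\<in>T. ?d $ i * y $ i)"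
      proof (intro sum_mono2 sum_nonneg)
        fix T i assume "T \<in> set Ts - Q" "i \<in> T"
        then have "i < n" using part_subset by blast
        then show "0 \<le> ?d $ i * y $ i" using y0 d0 by (intro mult_nonneg_nonneg) auto
      qed (use Q in auto)
      also have "\<dots> = ?d \<bullet> y"
        by (simp only: sum_parts[symmetric] scalar_prod_def dim atLeast0LessThan)
      finally show "ereal (C \<bullet> x + (\<Sum>T\<in>Q. Min ((\<lambda>i. c' i + u i) ` T))) \<le> ereal (C \<bullet> x + ?d \<bullet> y)"
        by simp
    qed
    also have "\<dots> \<le> cost x" unfolding two_stage_cost_def using d by (intro SUP_upper)
    also have "\<dots> \<le> ereal V" by (rule V)
    finally show "(\<Sum>T\<in>Q. Min ((\<lambda>i. c' i + u i) ` T)) \<le> V - C \<bullet> x" by simp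
  qed (use Q Us \<Gamma> in auto)
  then obtain l :: "nat \<Rightarrow> real" where l: "\<And>j. 0 \<le> l j" "\<And>j. l j \<le> 1"
    "\<And>t. (\<Sum>j<K. \<Gamma> $ j * l j) + (\<Sum>T\<in>Q. dual_value 1 (wt l) c' T (t T)) \<le> V - C \<bullet> x"
    by blast
  define k where "k = (\<lambda>j. \<lfloor>N * l j\<rfloor>)"
  have N0: "0 \<le> real_of_int N" "M \<le> real_of_int N"
    using M N of_nat_0_le_iff[of "n * K", where 'a = real] by linarith+
  have k: "0 \<le> k j \<and> k j \<le> N" for j
    using N0 l(1,2)[of j] by (auto simp: k_def floor_le_iff intro!: le_less_trans[OF mult_left_le])
  have card: "real (card T * K) \<le> N - M" if "T \<in> Q" for T
  proof -
    have "card T \<le> n" using that Q(1) part_subset card_mono[of "{..<n}" T] by auto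
    then have "real (card T * K) \<le> real (n * K)" by (intro of_nat_mono mult_le_mono1)
    then show ?thesis using N by linarith
  qed
  have \<Gamma>l: "0 \<le> (\<Sum>j<K. \<Gamma> $ j * l j)" using \<Gamma> l by (intro sum_nonneg mult_nonneg_nonneg) auto
  have wt_nonneg: "0 \<le> wt l i" for i unfolding weight_def by (intro sum_nonneg) (simp add: l)
  \<comment> \<open>Otherwise the dual value of \<open>T\<close> would grow at least at rate
    \<open>e > 0\<close> in \<open>t\<close>. The point \<open>r\<close> is far enough out to exceed
    \<open>V - C \<bullet> x\<close>, with all other open parts held at \<open>t = 0\<close>, where
    they contribute 0.\<close>
  have full: "1 \<le> (\<Sum>i\<in>T. wt l i)" if T: "T \<in> Q" for T
  proof (rule ccontr)
    define e where "e = 1 - (\<Sum>i\<in>T. wt l i)"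
    assume "\<not> 1 \<le> (\<Sum>i\<in>T. wt l i)"
    then have e: "0 < e" by (simp add: e_def)
    define r where "r = (\<bar>V - C \<bullet> x\<bar> + 1) / e"
    have r: "0 \<le> r" "r * e = \<bar>V - C \<bullet> x\<bar> + 1" using e by (auto simp: r_def)
    have "(\<Sum>S\<in>Q. dual_value 1 (wt l) c' S (if S = T then r else 0)) = dual_value 1 (wt l) c' T r"
    proof -
      have "dual_value 1 (wt l) c' S 0 = 0" for S
        using c' by (simp add: dual_value_def max_absorb1)
      then show ?thesis using T Q(2)
        by (subst sum.remove[of _ T]) (auto intro!: sum.neutral)
    qed
    moreover have "r * e \<le> dual_value 1 (wt l) c' T r"
    proof -
      have "(\<Sum>i\<in>T. wt l i * max 0 (r - c' i)) \<le> (\<Sum>i\<in>T. wt l i * r)"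
        using c' r by (intro sum_mono mult_left_mono wt_nonneg) auto
      also have "\<dots> = (\<Sum>i\<in>T. wt l i) * r" by (simp only: sum_distrib_right)
      finally show ?thesis by (simp add: dual_value_def e_def right_diff_distrib mult.commute)
    qed
    ultimately show False using l(3)[of "\<lambda>S. if S = T then r else 0"] \<Gamma>l r(2) by linarith
  qed
  \<comment> \<open>The scaled weights sum to at least \<open>N\<close>, and the floors cost at most
    \<open>card T * K\<close>, which fits into \<open>N - M\<close>.\<close>
  have feasible: "M \<le> (\<Sum>i\<in>T. wt (\<lambda>j. k j) i)" if T: "T \<in> Q" for T
  proof -
    have "real_of_int N * 1 \<le> real_of_int N * (\<Sum>i\<in>T. wt l i)" by (intro mult_left_mono full T N0)
    moreover have "(\<Sum>i\<in>T. N * wt l i - K) \<le> (\<Sum>i\<in>T. wt (\<lambda>j. k j) i)"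
      unfolding k_def by (intro sum_mono weight_floor l)
    ultimately show ?thesis using card[OF T] by (simp add: sum_subtractf sum_distrib_left)
  qed
  have bound: "(\<Sum>j<K. \<Gamma> $ j * k j) + (\<Sum>T\<in>Q. dual_value M (wt (\<lambda>j. k j)) (($) c) T (t T))
        + (\<Sum>T\<in>set Ts - Q. M * m T) \<le> N * V"
    if t: "\<forall>T\<in>Q. 0 \<le> t T" and m: "\<forall>T\<in>set Ts. 0 \<le> m T \<and> (\<forall>i\<in>T. m T \<le> C $ i)" for t m
  proof -
    have "(\<Sum>j<K. \<Gamma> $ j * k j) \<le> (\<Sum>j<K. N * (\<Gamma> $ j * l j))"
    proof (rule sum_mono)
      fix j assume "j \<in> {..<K}"
      then have "\<Gamma> $ j * k j \<le> \<Gamma> $ j * (N * l j)"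
        using \<Gamma> by (intro mult_left_mono) (auto simp: k_def)
      then show "\<Gamma> $ j * k j \<le> N * (\<Gamma> $ j * l j)" by (simp add: algebra_simps)
    qed
    moreover have "(\<Sum>T\<in>Q. dual_value M (wt (\<lambda>j. k j)) (($) c) T (t T))
        \<le> (\<Sum>T\<in>Q. N * dual_value 1 (wt l) c' T (t T))"
    proof (rule sum_mono)
      fix T assume T: "T \<in> Q"
      have "dual_value M (wt (\<lambda>j. k j)) (($) c) T (t T) = dual_value M (wt (\<lambda>j. k j)) c' T (t T)"
        using T Q(1) part_subset unfolding dual_value_def
        by (intro arg_cong2[where f = "(-)"] sum.cong refl) (auto simp: c'_def)
      also have "\<dots> \<le> N * dual_value 1 (wt l) c' T (t T)"
        unfolding k_def using T t by (intro dual_value_floor l c' card) auto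
      finally show "dual_value M (wt (\<lambda>j. k j)) (($) c) T (t T) \<le> N * dual_value 1 (wt l) c' T (t T)" .
    qed
    moreover have "(\<Sum>T\<in>set Ts - Q. M * m T) \<le> N * (C \<bullet> x)"
    proof -
      have x0: "x $ i = 0 \<or> x $ i = 1" if "i < n" for i
        using xb that by (auto simp: binary_vecs_def)
      have Cx0: "0 \<le> C $ i * x $ i" if "i < n" for i using x0[OF that] C that by auto
      have "(\<Sum>T\<in>set Ts - Q. m T) \<le> (\<Sum>T\<in>set Ts - Q. \<Sum>i\<in>T. C $ i * x $ i)"
      proof (rule sum_mono)
        fix T assume T: "T \<in> set Ts - Q"
        then have sub: "T \<subseteq> {..<n}" using part_subset by auto
        then obtain i where i: "i \<in> T" "x $ i = 1" using T x0 by (auto simp: Q_def)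
        have "m T \<le> C $ i * x $ i" using m T i by auto
        also have "\<dots> \<le> (\<Sum>i\<in>T. C $ i * x $ i)"
          using i sub T part_finite Cx0 by (intro member_le_sum) auto
        finally show "m T \<le> (\<Sum>i\<in>T. C $ i * x $ i)" .
      qed
      also have "\<dots> \<le> (\<Sum>T\<in>set Ts. \<Sum>i\<in>T. C $ i * x $ i)"
        using Cx0 part_subset by (intro sum_mono2) (auto intro!: sum_nonneg)
      also have "\<dots> = C \<bullet> x"
        using xb by (auto simp: sum_parts[symmetric] scalar_prod_def binary_vecs_def atLeast0LessThan)
      finally have le: "(\<Sum>T\<in>set Ts - Q. m T) \<le> C \<bullet> x" .
      have "0 \<le> (\<Sum>T\<in>set Ts - Q. m T)" using m by (intro sum_nonneg) auto
      then have "M * (\<Sum>T\<in>set Ts - Q. m T) \<le> N * (C \<bullet> x)"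
        using le N0 M by (intro mult_mono) auto
      then show ?thesis by (simp add: sum_distrib_left)
    qed
    moreover have "N * ((\<Sum>j<K. \<Gamma> $ j * l j) + (\<Sum>T\<in>Q. dual_value 1 (wt l) c' T (t T)))
        \<le> N * (V - C \<bullet> x)"
      by (intro mult_left_mono l(3) N0)
    ultimately show ?thesis by (simp add: sum_distrib_left algebra_simps)
  qed
  show ?thesis
    using Q(1) k feasible bound by blast
qed

end

section \<open>The algorithm\<close>

type_synonym fractions = "(int \<times> int) list"

text \<open>The last component mirrors the \<open>Num 0\<close> that terminates
  \<open>enc_list\<close>; \<open>code_of\<close> sets it to 0, so that the tuple has the prescribed
  encoding.\<close>

type_synonym rs_code =
  "int \<times> int list list \<times> fractions \<times> fractions \<times> int list list \<times> fractions \<times> int"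

definition scale :: "int \<Rightarrow> fractions \<Rightarrow> int list" where
  "scale d = map (\<lambda>q. fst q * (d div snd q))"

lemma ptime_scale:
  assumes "ptime d" "ptime qs"
  shows "ptime (\<lambda>x. scale (d x) (qs x))"
  unfolding scale_def by (intro ptime_intros assms assms[THEN ptime_comp])

context
  fixes K :: nat
begin

definition weight_code :: "int list list \<Rightarrow> int list \<Rightarrow> int \<Rightarrow> int" where
  "weight_code Us k i =
    (\<Sum>j<K. if i \<in> set (lookup [] Us (int j)) then lookup 0 k (int j) else 0)"

definition dual_code :: "int \<Rightarrow> int list \<Rightarrow> int list list \<Rightarrow> int list \<Rightarrow> int list \<Rightarrow> int \<Rightarrow> int" where
  "dual_code M c Us k T t = M * t -
    sum_list (map (\<lambda>i. weight_code Us k i *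
      (if lookup 0 c i \<le> t then t - lookup 0 c i else 0)) T)"

text \<open>\<open>best\<close> minimises, so the largest value over the breakpoints is found with
  reversed sign.\<close>

definition open_code :: "int \<Rightarrow> int list \<Rightarrow> int list list \<Rightarrow> int list \<Rightarrow> int list \<Rightarrow> int" where
  "open_code M c Us k T = dual_code M c Us k T
    (lookup 0 c (best (\<lambda>i. 0 - dual_code M c Us k T (lookup 0 c i)) (lookup 0 T 0) T))"

definition cheapest :: "int list \<Rightarrow> int list \<Rightarrow> int" where
  "cheapest C T = best (lookup 0 C) (lookup 0 T 0) T"

text \<open>If the weights sum to less than \<open>M\<close>, the dual function increases without
  bound and its values at breakpoints certify nothing, so the part is closed whatever it
  costs.\<close>

definition closed_code ::
    "int \<Rightarrow> int list \<Rightarrow> int list \<Rightarrow> int list list \<Rightarrow> int list \<Rightarrow> int list \<Rightarrow> bool" where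
  "closed_code M C c Us k T \<longleftrightarrow>
    sum_list (map (weight_code Us k) T) < M \<or>
    M * lookup 0 C (cheapest C T) \<le> open_code M c Us k T"

definition value_code ::
    "int \<Rightarrow> int list list \<Rightarrow> int list \<Rightarrow> int list \<Rightarrow> int list list \<Rightarrow> int list \<Rightarrow> int list \<Rightarrow> int" where
  "value_code M Ts C c Us \<Gamma> k =
    (\<Sum>j<K. lookup 0 \<Gamma> (int j) * lookup 0 k (int j)) +
    sum_list (map (\<lambda>T. if closed_code M C c Us k T then M * lookup 0 C (cheapest C T)
      else open_code M c Us k T) Ts)"

primrec grid :: "nat \<Rightarrow> int list \<Rightarrow> int list list" where
  "grid 0 R = [[]]"
| "grid (Suc m) R = concat (map (\<lambda>k. map (\<lambda>a. a # k) R) (grid m R))"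

text \<open>\<open>R\<close> serves twice: as the values of the grid and, filtered by
  \<open>i < n\<close>, as the index list of the output vector. The latter requires
  \<open>N >= n\<close>, or at least \<open>N + 1 >= n\<close>.\<close>

definition solve_code ::
    "int \<Rightarrow> int \<Rightarrow> int list list \<Rightarrow> int list \<Rightarrow> int list \<Rightarrow> int list list \<Rightarrow> int list \<Rightarrow> int list \<Rightarrow> int list" where
  "solve_code n M Ts C c Us \<Gamma> R =
    map (\<lambda>i. if i \<in> set (map (cheapest C) (filter (closed_code M C c Us
        (best (value_code M Ts C c Us \<Gamma>) (lookup [] (grid K R) 0) (grid K R))) Ts)) then 1 else 0)
      (filter (\<lambda>i. i < n) R)"

text \<open>Here \<open>(a, b)\<close> is the accuracy as a fraction, so \<open>b div a + 1\<close>
  is an integer above 1/eps. The final 1 keeps \<open>M\<close> positive when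
  \<open>n = 0\<close>.\<close>

definition scaling :: "rs_code \<times> int \<times> int \<Rightarrow> int" where
  "scaling v = (case v of ((n, Ts, C, c, Us, \<Gamma>, _), a, b) \<Rightarrow>
    n * (int K + 1) * (b div a + 1) + 1)"

definition grid_bound :: "rs_code \<times> int \<times> int \<Rightarrow> int" where
  "grid_bound v = scaling v + fst (fst v) * (int K + 1)"

text \<open>The product of all denominators serves as common denominator: its bit size is at most
  the sum of theirs, so no gcd computation is involved.\<close>

definition fptas_code :: "(rs_code \<times> int \<times> int) \<times> int list \<Rightarrow> int list" where
  "fptas_code z = (case z of (((n, Ts, C, c, Us, \<Gamma>, u), a, b), R) \<Rightarrow>
    (let d = prod_list (map snd C) * prod_list (map snd c) * prod_list (map snd \<Gamma>) in
      solve_code n (scaling ((n, Ts, C, c, Us, \<Gamma>, u), a, b)) Ts (scale d C) (scale d c) Us (scale d \<Gamma>) R))"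

section \<open>Polynomial running time of the algorithm\<close>

lemma ptime_weight_code:
  assumes "ptime Us" "ptime k" "ptime i"
  shows "ptime (\<lambda>x. weight_code (Us x) (k x) (i x))"
  unfolding weight_code_def by (intro ptime_intros assms)

lemma ptime_dual_code:
  assumes "ptime M" "ptime c" "ptime Us" "ptime k" "ptime T" "ptime t"
  shows "ptime (\<lambda>x. dual_code (M x) (c x) (Us x) (k x) (T x) (t x))"
  unfolding dual_code_def
  by (intro ptime_intros ptime_weight_code assms assms[THEN ptime_comp])

lemma ptime_open_code:
  assumes "ptime M" "ptime c" "ptime Us" "ptime k" "ptime T"
  shows "ptime (\<lambda>x. open_code (M x) (c x) (Us x) (k x) (T x))"
  unfolding open_code_def
  by (intro ptime_intros ptime_dual_code assms assms[THEN ptime_comp])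

lemma ptime_cheapest:
  assumes "ptime C" "ptime T"
  shows "ptime (\<lambda>x. cheapest (C x) (T x))"
  unfolding cheapest_def by (intro ptime_intros assms assms[THEN ptime_comp])

lemma ptime_closed_code:
  assumes "ptime M" "ptime C" "ptime c" "ptime Us" "ptime k" "ptime T"
  shows "ptime (\<lambda>x. closed_code (M x) (C x) (c x) (Us x) (k x) (T x))"
  unfolding closed_code_def
  by (intro ptime_intros ptime_weight_code ptime_open_code ptime_cheapest assms
      assms[THEN ptime_comp])

lemma ptime_value_code:
  assumes "ptime M" "ptime Ts" "ptime C" "ptime c" "ptime Us" "ptime \<Gamma>" "ptime k"
  shows "ptime (\<lambda>x. value_code (M x) (Ts x) (C x) (c x) (Us x) (\<Gamma> x) (k x))"
  unfolding value_code_def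
  by (intro ptime_intros ptime_closed_code ptime_open_code ptime_cheapest assms
      assms[THEN ptime_comp])

text \<open>Here the constancy of \<open>K\<close> is essential: the program is built by recursion
  on \<open>m\<close>, and the number of grid points is the \<open>m\<close>-th power of the length
  of \<open>R\<close>.\<close>

lemma ptime_grid:
  assumes "ptime R"
  shows "ptime (\<lambda>x. grid m (R x))"
  by (induction m) (auto intro!: ptime_intros assms assms[THEN ptime_comp])

lemma ptime_solve_code:
  assumes "ptime n" "ptime M" "ptime Ts" "ptime C" "ptime c" "ptime Us" "ptime \<Gamma>" "ptime R"
  shows "ptime (\<lambda>x. solve_code (n x) (M x) (Ts x) (C x) (c x) (Us x) (\<Gamma> x) (R x))"
  unfolding solve_code_def
  by (intro ptime_intros ptime_closed_code ptime_value_code ptime_cheapest ptime_grid assms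
      assms[THEN ptime_comp])

lemma ptime_scaling: "ptime scaling"
  unfolding scaling_def case_prod_beta by (intro ptime_intros)

lemma ptime_grid_bound: "ptime grid_bound"
  unfolding grid_bound_def by (intro ptime_intros ptime_scaling)

lemma ptime_fptas_code: "ptime fptas_code"
  unfolding fptas_code_def case_prod_beta Let_def
  by (intro ptime_intros ptime_solve_code ptime_scale ptime_comp[OF ptime_scaling])

end

section \<open>Correctness of the algorithm\<close>

definition fractions_of :: "rat vec \<Rightarrow> fractions" where
  "fractions_of v = map quotient_of (list_of_vec v)"

definition ints_of :: "nat set \<Rightarrow> int list" where
  "ints_of A = map int (sorted_list_of_set A)"

definition code_of :: "RS_instance \<Rightarrow> rs_code" where
  "code_of I = (int (dimen I), map ints_of (parts I), fractions_of (first_cost I),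
    fractions_of (nominal_cost I), map ints_of (budget_sets I), fractions_of (budgets I), 0)"

lemma encode_quotient_of: "encode (quotient_of r) = enc_rat r"
  by (simp add: enc_rat_def encode_prod_def encode_int_def case_prod_beta)

lemma encode_fractions_of: "encode (fractions_of v) = enc_rat_vec v"
  by (simp add: fractions_of_def enc_rat_vec_def encode_list_def encode_quotient_of comp_def)

lemma encode_ints_of: "encode (ints_of A) = enc_set A"
  by (simp add: ints_of_def enc_set_def encode_list_def encode_int_def comp_def)

lemma encode_code_of: "encode (code_of I) = enc_RS_instance I"
proof -
  have "encode (map ints_of As) = enc_list (map enc_set As)" for As
    by (simp add: encode_list_def[of "map ints_of As"] encode_ints_of comp_def)
  then show ?thesis
    by (simp add: code_of_def enc_RS_instance_def encode_prod_def encode_fractions_of)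
      (simp add: encode_int_def)
qed

lemma set_ints_of: "finite A \<Longrightarrow> set (ints_of A) = int ` A"
  by (simp add: ints_of_def)

lemma sum_list_ints_of: "finite A \<Longrightarrow> sum_list (map f (ints_of A)) = (\<Sum>i\<in>A. f (int i))"
  by (simp add: ints_of_def comp_def sum_list_distinct_conv_sum_set)

lemma insert_lookup: "xs \<noteq> [] \<Longrightarrow> insert (lookup d xs 0) (set xs) = set xs"
  by (rule insert_absorb) (simp add: lookup_def)

lemma lookup_scale:
  assumes "i < dim_vec v" "\<And>q. q \<in> set (fractions_of v) \<Longrightarrow> snd q dvd d"
  shows "real_of_int (lookup 0 (scale d (fractions_of v)) (int i)) = real_of_int d * of_rat (v $ i)"
proof -
  obtain a b where ab: "quotient_of (v $ i) = (a, b)" by fastforce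
  have len: "i < length (list_of_vec v)" using assms by simp
  have nth: "list_of_vec v ! i = v $ i" using assms(1) by (simp add: list_of_vec_index)
  have "quotient_of (list_of_vec v ! i) \<in> set (fractions_of v)"
    unfolding fractions_of_def set_map by (intro imageI nth_mem len)
  then have "(a, b) \<in> set (fractions_of v)" by (simp add: nth ab)
  then have "b dvd d" using assms(2) by fastforce
  moreover have "0 < b" using ab by (rule quotient_of_denom_pos)
  moreover have "real_of_rat (v $ i) = of_int a / of_int b"
    using quotient_of_div[OF ab] by (simp add: of_rat_divide)
  ultimately show ?thesis
    using len nth ab by (auto simp: scale_def fractions_of_def lookup_nth real_of_int_div)
qed

lemma set_grid: "set (grid m R) = {k. length k = m \<and> set k \<subseteq> set R}"
proof (induction m)
  case (Suc m)
  show ?case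
  proof (intro equalityI subsetI)
    fix k assume "k \<in> {k. length k = Suc m \<and> set k \<subseteq> set R}"
    then show "k \<in> set (grid (Suc m) R)" using Suc by (cases k) auto
  qed (use Suc in auto)
qed auto

lemma filter_less_upto:
  assumes "int n \<le> N + 1"
  shows "filter (\<lambda>i. i < int n) [0..N] = map int [0..<n]"
proof -
  have "[0..N] = [0..int n - 1] @ [int n..N]"
  proof (cases "int n \<le> N")
    case False
    then have "N = int n - 1" using assms by linarith
    then show ?thesis by simp
  qed (rule upto_split1, auto)
  moreover have "filter (\<lambda>i. i < int n) [0..int n - 1] = [0..int n - 1]"
    by (rule filter_True) auto
  moreover have "filter (\<lambda>i. i < int n) [int n..N] = []"
    by (rule filter_False) auto
  moreover have "[0..int n - 1] = map int [0..<n]"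
    by (induction n) (simp_all add: upto_rec2)
  ultimately show ?thesis by simp
qed

locale RS_code =
  fixes K :: nat and I :: RS_instance and M N :: int
  assumes I: "I \<in> RS_instances K" and M: "0 < M"
    and N: "M + int (dimen I * K) \<le> N" "int (dimen I) \<le> N"
begin

abbreviation n :: nat where "n \<equiv> dimen I"

definition denominator :: int where
  "denominator = prod_list (map snd (fractions_of (first_cost I))) *
    prod_list (map snd (fractions_of (nominal_cost I))) *
    prod_list (map snd (fractions_of (budgets I)))"

abbreviation C' :: "int list" where "C' \<equiv> scale denominator (fractions_of (first_cost I))"
abbreviation c' :: "int list" where "c' \<equiv> scale denominator (fractions_of (nominal_cost I))"
abbreviation \<Gamma>' :: "int list" where "\<Gamma>' \<equiv> scale denominator (fractions_of (budgets I))"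
abbreviation Us' :: "int list list" where "Us' \<equiv> map ints_of (budget_sets I)"
abbreviation C :: "real vec" where "C \<equiv> map_vec of_rat (first_cost I)"
abbreviation c :: "real vec" where "c \<equiv> map_vec of_rat (nominal_cost I)"
abbreviation \<Gamma> :: "real vec" where "\<Gamma> \<equiv> map_vec of_rat (budgets I)"

sublocale two_stage_RS n K "parts I" "budget_sets I" C c \<Gamma>
  using I by unfold_locales (auto simp: RS_instances_def)

lemma dims: "dim_vec (first_cost I) = n" "dim_vec (nominal_cost I) = n" "dim_vec (budgets I) = K"
  using I by (auto simp: RS_instances_def)

lemma denominator_pos: "0 < denominator"
proof -
  have "0 < prod_list (map snd qs)" if "\<forall>q\<in>set qs. 0 < snd q" for qs :: fractions
    using that by (induction qs) auto
  moreover have "\<forall>q\<in>set (fractions_of v). 0 < snd q" for v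
    using quotient_of_denom_pos' by (auto simp: fractions_of_def)
  ultimately have "0 < prod_list (map snd (fractions_of v))" for v by blast
  then show ?thesis by (simp add: denominator_def)
qed

lemma
  shows lookup_C: "i < n \<Longrightarrow> real_of_int (lookup 0 C' (int i)) = denominator * C $ i"
    and lookup_c: "i < n \<Longrightarrow> real_of_int (lookup 0 c' (int i)) = denominator * c $ i"
    and lookup_\<Gamma>: "j < K \<Longrightarrow> real_of_int (lookup 0 \<Gamma>' (int j)) = denominator * \<Gamma> $ j"
proof -
  have dvd: "snd q dvd prod_list (map snd (fractions_of v))" if "q \<in> set (fractions_of v)" for q v
    using that by (intro prod_list_dvd) auto
  show "i < n \<Longrightarrow> real_of_int (lookup 0 C' (int i)) = denominator * C $ i"
    by (subst lookup_scale) (auto simp: dims denominator_def dvd)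
  show "i < n \<Longrightarrow> real_of_int (lookup 0 c' (int i)) = denominator * c $ i"
    by (subst lookup_scale) (auto simp: dims denominator_def dvd)
  show "j < K \<Longrightarrow> real_of_int (lookup 0 \<Gamma>' (int j)) = denominator * \<Gamma> $ j"
    by (subst lookup_scale) (auto simp: dims denominator_def dvd)
qed

abbreviation entry :: "int list \<Rightarrow> nat \<Rightarrow> real" where
  "entry k \<equiv> \<lambda>j. real_of_int (lookup 0 k (int j))"

lemma weight_code: "real_of_int (weight_code K Us' k (int i)) = wt (entry k) i"
proof -
  have "int i \<in> set (lookup [] Us' (int j)) \<longleftrightarrow> i \<in> budget_sets I ! j" if "j < K" for j
  proof -
    have "finite (budget_sets I ! j)" using Us(2)[OF that] finite_subset by blast
    then show ?thesis using that Us(1) by (auto simp: lookup_nth set_ints_of)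
  qed
  then show ?thesis by (auto simp: weight_code_def weight_def intro!: sum.cong)
qed

text \<open>Multiplying all prices and \<open>t\<close> by one positive factor multiplies
  \<open>dual_value\<close> by it, so integer arithmetic on the scaled prices is exact.\<close>

lemma dual_code:
  assumes "T \<in> set (parts I)"
  shows "real_of_int (dual_code K M c' Us' k (ints_of T) t)
    = denominator * dual_value M (wt (entry k)) (($) c) T (t / denominator)"
proof -
  have "real_of_int (weight_code K Us' k (int i) *
      (if lookup 0 c' (int i) \<le> t then t - lookup 0 c' (int i) else 0))
    = denominator * (wt (entry k) i * max 0 (t / denominator - c $ i))" if "i \<in> T" for i
  proof -
    have "i < n" using that assms part_subset by blast
    note i = lookup_c[OF this]
    have le: "lookup 0 c' (int i) \<le> t \<longleftrightarrow> denominator * c $ i \<le> t"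
      unfolding i[symmetric] by linarith
    have "denominator * max 0 (t / denominator - c $ i) = max 0 (t - denominator * c $ i)"
      using denominator_pos by (simp add: max_def field_simps)
    also have "\<dots> = real_of_int (if lookup 0 c' (int i) \<le> t then t - lookup 0 c' (int i) else 0)"
      unfolding le using i by auto
    finally show ?thesis by (simp add: weight_code)
  qed
  then have "real_of_int (sum_list (map (\<lambda>i. weight_code K Us' k i *
      (if lookup 0 c' i \<le> t then t - lookup 0 c' i else 0)) (ints_of T)))
    = (\<Sum>i\<in>T. denominator * (wt (entry k) i * max 0 (t / denominator - c $ i)))"
    unfolding sum_list_ints_of[OF part_finite[OF assms]] of_int_sum by (rule sum.cong[OF refl])
  then show ?thesis
    using denominator_pos
    unfolding dual_code_def dual_value_def of_int_diff right_diff_distrib sum_distrib_left by simp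
qed

definition open_value :: "int list \<Rightarrow> nat set \<Rightarrow> real" where
  "open_value k T = open_code K M c' Us' k (ints_of T) / denominator"

lemma dual_code_at:
  assumes "T \<in> set (parts I)" "i \<in> T"
  shows "real_of_int (dual_code K M c' Us' k (ints_of T) (lookup 0 c' (int i)))
    = denominator * dual_value M (wt (entry k)) (($) c) T (c $ i)"
proof -
  have "i < n" using assms part_subset by blast
  then show ?thesis using denominator_pos by (simp add: dual_code[OF assms(1)] lookup_c)
qed

lemma ints_of_part: "T \<in> set (parts I) \<Longrightarrow> ints_of T \<noteq> [] \<and> set (ints_of T) = int ` T"
  using part_finite part_nonempty by (auto simp: set_ints_of ints_of_def)

lemma open_value:
  assumes T: "T \<in> set (parts I)"
  shows "\<exists>i\<in>T. open_value k T = dual_value M (wt (entry k)) (($) c) T (c $ i)"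
    and "i \<in> T \<Longrightarrow> dual_value M (wt (entry k)) (($) c) T (c $ i) \<le> open_value k T"
proof -
  let ?f = "\<lambda>i. dual_code K M c' Us' k (ints_of T) (lookup 0 c' i)"
  let ?b = "best (\<lambda>i. 0 - ?f i) (lookup 0 (ints_of T) 0) (ints_of T)"
  have ins: "insert (lookup 0 (ints_of T) 0) (set (ints_of T)) = int ` T"
    using ints_of_part[OF T] insert_lookup by metis
  have "?b \<in> int ` T" using best_mem[of "\<lambda>i. 0 - ?f i"] unfolding ins[symmetric] .
  then obtain j where j: "j \<in> T" "?b = int j" by blast
  then have eq: "open_value k T = dual_value M (wt (entry k)) (($) c) T (c $ j)"
    using denominator_pos by (simp add: open_value_def open_code_def dual_code_at[OF T])
  then show "\<exists>i\<in>T. open_value k T = dual_value M (wt (entry k)) (($) c) T (c $ i)"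
    using j by blast
  assume i: "i \<in> T"
  have "0 - ?f ?b \<le> 0 - ?f (int i)"
    using best_le[of "int i" "lookup 0 (ints_of T) 0" "ints_of T" "\<lambda>i. 0 - ?f i"] i ins by blast
  then have "real_of_int (?f (int i)) \<le> real_of_int (?f (int j))" unfolding j by simp
  then show "dual_value M (wt (entry k)) (($) c) T (c $ i) \<le> open_value k T"
    unfolding eq dual_code_at[OF T i] dual_code_at[OF T j(1)] using denominator_pos by simp
qed

definition pick :: "nat set \<Rightarrow> nat" where
  "pick T = nat (cheapest C' (ints_of T))"

lemma pick:
  assumes T: "T \<in> set (parts I)"
  shows "pick T \<in> T" "cheapest C' (ints_of T) = int (pick T)"
    and "i \<in> T \<Longrightarrow> C $ pick T \<le> C $ i"
proof -
  have ins: "insert (lookup 0 (ints_of T) 0) (set (ints_of T)) = int ` T"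
    using ints_of_part[OF T] insert_lookup by metis
  have "cheapest C' (ints_of T) \<in> int ` T"
    using best_mem unfolding ins[symmetric] cheapest_def .
  then show *: "pick T \<in> T" "cheapest C' (ints_of T) = int (pick T)"
    by (auto simp: pick_def)
  assume i: "i \<in> T"
  have "lookup 0 C' (cheapest C' (ints_of T)) \<le> lookup 0 C' (int i)"
    unfolding cheapest_def using i ins by (intro best_le) auto
  then have "real_of_int (lookup 0 C' (int (pick T))) \<le> real_of_int (lookup 0 C' (int i))"
    using *(2) by simp
  moreover have "pick T < n" "i < n" using * i T part_subset by auto
  ultimately show "C $ pick T \<le> C $ i" using denominator_pos by (simp add: lookup_C)
qed

lemma lookup_pick:
  "T \<in> set (parts I) \<Longrightarrow> real_of_int (lookup 0 C' (cheapest C' (ints_of T))) = denominator * C $ pick T"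
  using pick[of T] part_subset[of T] by (auto simp: lookup_C)

definition closed_parts :: "int list \<Rightarrow> nat set set" where
  "closed_parts k = {T \<in> set (parts I). closed_code K M C' c' Us' k (ints_of T)}"

lemma closed_parts_iff:
  assumes "T \<in> set (parts I)"
  shows "T \<in> closed_parts k \<longleftrightarrow>
    (\<Sum>i\<in>T. wt (entry k) i) < M \<or> M * C $ pick T \<le> open_value k T"
proof -
  have "sum_list (map (weight_code K Us' k) (ints_of T)) < M
      \<longleftrightarrow> real_of_int (\<Sum>i\<in>T. weight_code K Us' k (int i)) < M"
    using part_finite[OF assms] by (simp add: sum_list_ints_of del: of_int_sum)
  moreover have "M * lookup 0 C' (cheapest C' (ints_of T)) \<le> open_code K M c' Us' k (ints_of T)
      \<longleftrightarrow> real_of_int M * (denominator * C $ pick T) \<le> real_of_int (open_code K M c' Us' k (ints_of T))"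
    unfolding lookup_pick[OF assms, symmetric] by (metis of_int_le_iff of_int_mult)
  moreover have "real_of_int M * (denominator * C $ pick T)
      \<le> real_of_int (open_code K M c' Us' k (ints_of T)) \<longleftrightarrow> M * C $ pick T \<le> open_value k T"
    using denominator_pos
    by (simp add: open_value_def pos_le_divide_eq mult.commute mult.left_commute)
  ultimately show ?thesis
    using assms by (simp only: closed_parts_def closed_code_def mem_Collect_eq weight_code of_int_sum simp_thms)
qed

abbreviation part_value :: "int list \<Rightarrow> nat set \<Rightarrow> real" where
  "part_value k T \<equiv> if T \<in> closed_parts k then M * C $ pick T else open_value k T"

lemma value_code:
  "real_of_int (value_code K M (map ints_of (parts I)) C' c' Us' \<Gamma>' k)
    = denominator * ((\<Sum>j<K. \<Gamma> $ j * entry k j) + (\<Sum>T\<in>set (parts I). part_value k T))"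
proof -
  have dist: "distinct (parts I)" using I by (simp add: RS_instances_def)
  have "real_of_int (if closed_code K M C' c' Us' k (ints_of T)
      then M * lookup 0 C' (cheapest C' (ints_of T)) else open_code K M c' Us' k (ints_of T))
    = denominator * part_value k T" if "T \<in> set (parts I)" for T
    using that denominator_pos by (simp add: lookup_pick open_value_def closed_parts_def)
  then have parts: "real_of_int (sum_list (map (\<lambda>T. if closed_code K M C' c' Us' k T
      then M * lookup 0 C' (cheapest C' T) else open_code K M c' Us' k T) (map ints_of (parts I))))
    = denominator * (\<Sum>T\<in>set (parts I). part_value k T)"
    unfolding sum_distrib_left map_map comp_def
      sum_list_distinct_conv_sum_set[OF dist] of_int_sum by (rule sum.cong[OF refl])
  have "real_of_int (\<Sum>j<K. lookup 0 \<Gamma>' (int j) * lookup 0 k (int j))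
    = denominator * (\<Sum>j<K. \<Gamma> $ j * entry k j)"
    by (simp add: lookup_\<Gamma> sum_distrib_left mult.assoc)
  then show ?thesis
    unfolding value_code_def of_int_add distrib_left parts by (rule arg_cong)
qed

section \<open>The best grid point and its approximation guarantee\<close>

definition best_grid :: "int list" where
  "best_grid = best (value_code K M (map ints_of (parts I)) C' c' Us' \<Gamma>')
    (lookup [] (grid K [0..N]) 0) (grid K [0..N])"

lemma N_nonneg: "0 \<le> N"
  using N(2) by linarith

lemma grid_insert: "insert (lookup [] (grid K [0..N]) 0) (set (grid K [0..N])) = set (grid K [0..N])"
proof -
  have "replicate K 0 \<in> set (grid K [0..N])" unfolding set_grid using N_nonneg by auto
  then show ?thesis by (intro insert_lookup) auto
qed

lemma best_grid_mem: "best_grid \<in> set (grid K [0..N])"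
  unfolding best_grid_def by (subst grid_insert[symmetric]) (rule best_mem)

lemma best_grid_le:
  "k \<in> set (grid K [0..N]) \<Longrightarrow>
    value_code K M (map ints_of (parts I)) C' c' Us' \<Gamma>' best_grid
    \<le> value_code K M (map ints_of (parts I)) C' c' Us' \<Gamma>' k"
  unfolding best_grid_def using grid_insert by (intro best_le) blast

definition solution :: "real vec" where
  "solution = selection pick (closed_parts best_grid)"

lemma solution_first_stage: "solution \<in> first_stage n X"
  unfolding solution_def by (rule selection_first_stage) (auto simp: closed_parts_def pick)

lemma solve_code:
  "encode (solve_code K (int n) M (map ints_of (parts I)) C' c' Us' \<Gamma>' [0..N])
    = enc_binary_vec solution"
proof -
  have "set (map (cheapest C') (filter (closed_code K M C' c' Us' best_grid) (map ints_of (parts I))))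
      = (\<lambda>T. cheapest C' (ints_of T)) ` closed_parts best_grid"
    by (auto simp: closed_parts_def)
  also have "\<dots> = (\<lambda>T. int (pick T)) ` closed_parts best_grid"
    by (intro image_cong refl pick(2)) (simp add: closed_parts_def)
  finally have "int i \<in> set (map (cheapest C') (filter (closed_code K M C' c' Us' best_grid)
      (map ints_of (parts I)))) \<longleftrightarrow> i \<in> pick ` closed_parts best_grid" for i
    by (simp only:) auto
  then have "solve_code K (int n) M (map ints_of (parts I)) C' c' Us' \<Gamma>' [0..N]
    = map (\<lambda>i. if i \<in> pick ` closed_parts best_grid then 1 else 0) [0..<n]"
    unfolding solve_code_def best_grid_def[symmetric] using N(2)
    by (simp add: filter_less_upto del: set_map)
  moreover have "list_of_vec solution = map (\<lambda>i. if i \<in> pick ` closed_parts best_grid then 1 else 0) [0..<n]"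
    unfolding solution_def selection_def by (rule nth_equalityI) (auto simp: list_of_vec_index)
  ultimately show ?thesis
    by (auto simp: enc_binary_vec_def encode_list_def encode_int_def intro!: arg_cong[of _ _ enc_list])
qed

text \<open>The rounded multipliers obtained from \<open>x\<close> form a grid point
  \<open>l\<close> of value at most \<open>N * V\<close>, since in every part the choice of the
  algorithm is no worse than that of \<open>x\<close>. The best grid point is no worse than
  \<open>l\<close>, and weak duality turns its value, divided by \<open>M\<close>, into a bound on
  the cost.\<close>

lemma cost_solution_le:
  assumes x: "x \<in> first_stage n X" and V: "cost x \<le> ereal V"
  shows "cost solution \<le> ereal (N / M * V)"
proof -
  have "real_of_int (M + int (n * K)) \<le> real_of_int N" using N(1) by (simp only: of_int_le_iff)
  then have N': "real_of_int M + real (n * K) \<le> real_of_int N" by simp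
  have M': "0 < real_of_int M" using M by simp
  obtain Q k where Q: "Q \<subseteq> set (parts I)" and k: "\<forall>j. 0 \<le> k j \<and> k j \<le> N"
    and feasible: "\<forall>T\<in>Q. M \<le> (\<Sum>i\<in>T. wt (\<lambda>j. real_of_int (k j)) i)"
    and value_le: "\<forall>t m. (\<forall>T\<in>Q. 0 \<le> t T) \<longrightarrow>
      (\<forall>T\<in>set (parts I). 0 \<le> m T \<and> (\<forall>i\<in>T. m T \<le> C $ i)) \<longrightarrow>
      (\<Sum>j<K. \<Gamma> $ j * k j) + (\<Sum>T\<in>Q. dual_value M (wt (\<lambda>j. real_of_int (k j))) (($) c) T (t T))
        + (\<Sum>T\<in>set (parts I) - Q. real_of_int M * m T) \<le> N * V"
    using rounded_multipliers_exist[OF x V M' N'] by (elim exE conjE) rule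
  define l where "l = map k [0..<K]"
  have l: "entry l j = k j" if "j < K" for j using that by (simp add: l_def lookup_nth)
  have wt_l: "wt (entry l) = wt (\<lambda>j. real_of_int (k j))"
    by (rule ext) (auto simp: weight_def l intro!: sum.cong)
  have l_grid: "l \<in> set (grid K [0..N])" using k by (auto simp: set_grid l_def)
  have open_ex: "\<forall>T\<in>set (parts I). \<exists>i\<in>T. open_value l T
      = dual_value M (wt (\<lambda>j. real_of_int (k j))) (($) c) T (c $ i)"
    using open_value(1)[of _ l] unfolding wt_l by blast
  then obtain a where a: "\<And>T. T \<in> set (parts I) \<Longrightarrow> a T \<in> T"
    "\<And>T. T \<in> set (parts I) \<Longrightarrow>
      open_value l T = dual_value M (wt (\<lambda>j. real_of_int (k j))) (($) c) T (c $ a T)"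
    by metis
  \<comment> \<open>The weights of \<open>l\<close> reach \<open>M\<close> on \<open>T\<close>, so
    the part is not closed by force and contributes the smaller of its two options.\<close>
  have part_Q: "part_value l T \<le> dual_value M (wt (\<lambda>j. real_of_int (k j))) (($) c) T (c $ a T)"
    if "T \<in> Q" for T
  proof -
    have T: "T \<in> set (parts I)" using that Q by blast
    have "M \<le> (\<Sum>i\<in>T. wt (entry l) i)" using feasible that unfolding wt_l by blast
    then have "T \<in> closed_parts l \<longleftrightarrow> M * C $ pick T \<le> open_value l T"
      unfolding closed_parts_iff[OF T] by linarith
    then show ?thesis unfolding a(2)[OF T, symmetric] by simp
  qed
  \<comment> \<open>A part that \<open>x\<close> closes is left open at \<open>l\<close> only if
    that is cheaper than closing it.\<close>
  have part_not_Q: "part_value l T \<le> M * C $ pick T" if "T \<in> set (parts I) - Q" for T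
    using closed_parts_iff[of T l] that by (cases "T \<in> closed_parts l") simp_all
  have "(\<Sum>T\<in>set (parts I). part_value l T)
      = (\<Sum>T\<in>Q. part_value l T) + (\<Sum>T\<in>set (parts I) - Q. part_value l T)"
    using Q by (simp add: sum.subset_diff[of Q] add.commute)
  also have "\<dots> \<le> (\<Sum>T\<in>Q. dual_value M (wt (\<lambda>j. real_of_int (k j))) (($) c) T (c $ a T))
      + (\<Sum>T\<in>set (parts I) - Q. M * C $ pick T)"
    by (intro add_mono sum_mono part_Q part_not_Q)
  finally have "(\<Sum>j<K. \<Gamma> $ j * entry l j) + (\<Sum>T\<in>set (parts I). part_value l T) \<le> N * V"
  proof -
    assume *: "(\<Sum>T\<in>set (parts I). part_value l T)
      \<le> (\<Sum>T\<in>Q. dual_value M (wt (\<lambda>j. real_of_int (k j))) (($) c) T (c $ a T))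
      + (\<Sum>T\<in>set (parts I) - Q. M * C $ pick T)"
    have "(\<Sum>j<K. \<Gamma> $ j * entry l j) = (\<Sum>j<K. \<Gamma> $ j * k j)" by (simp add: l)
    moreover have "\<forall>T\<in>Q. 0 \<le> c $ a T"
    proof
      fix T assume "T \<in> Q"
      then have "a T < n" using Q a(1) part_subset by blast
      then show "0 \<le> c $ a T" by (rule c(2))
    qed
    moreover have "\<forall>T\<in>set (parts I). 0 \<le> C $ pick T \<and> (\<forall>i\<in>T. C $ pick T \<le> C $ i)"
    proof
      fix T assume T: "T \<in> set (parts I)"
      then have "pick T < n" using pick(1) part_subset by blast
      then show "0 \<le> C $ pick T \<and> (\<forall>i\<in>T. C $ pick T \<le> C $ i)" using C(2) pick(3)[OF T] by blast
    qed
    ultimately show ?thesis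
      using value_le[rule_format, of "\<lambda>T. c $ a T" "\<lambda>T. C $ pick T"] * by auto
  qed
  then have "real_of_int (value_code K M (map ints_of (parts I)) C' c' Us' \<Gamma>' l)
      \<le> denominator * (N * V)"
    unfolding value_code using denominator_pos by (intro mult_left_mono) auto
  moreover have "real_of_int (value_code K M (map ints_of (parts I)) C' c' Us' \<Gamma>' best_grid)
      \<le> real_of_int (value_code K M (map ints_of (parts I)) C' c' Us' \<Gamma>' l)"
    using best_grid_le[OF l_grid] by (simp only: of_int_le_iff)
  ultimately have "denominator * ((\<Sum>j<K. \<Gamma> $ j * entry best_grid j)
      + (\<Sum>T\<in>set (parts I). part_value best_grid T)) \<le> denominator * (N * V)"
    unfolding value_code by linarith
  then have best: "(\<Sum>j<K. \<Gamma> $ j * entry best_grid j)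
      + (\<Sum>T\<in>set (parts I). part_value best_grid T) \<le> N * V"
    using denominator_pos by simp
  have sub: "closed_parts best_grid \<subseteq> set (parts I)" by (auto simp: closed_parts_def)
  have entry_nonneg: "0 \<le> entry best_grid j" for j
  proof (cases "j < length best_grid")
    case True
    have "set best_grid \<subseteq> {0..N}" using best_grid_mem by (simp add: set_grid)
    then have "best_grid ! j \<in> {0..N}" using nth_mem[OF True] by (rule subsetD)
    then show ?thesis using True by (simp add: lookup_nth)
  qed (simp add: lookup_def)
  have cost: "cost solution \<le> ereal (((\<Sum>j<K. \<Gamma> $ j * entry best_grid j)
      + (\<Sum>T\<in>closed_parts best_grid. M * C $ pick T)
      + (\<Sum>T\<in>set (parts I) - closed_parts best_grid. open_value best_grid T)) / M)"
    unfolding solution_def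
  \<comment> \<open>The parts left open at the best grid point passed the weight test, which is the
    feasibility that weak duality demands.\<close>
  proof (rule cost_selection_le[where k = "entry best_grid" and F = "open_value best_grid"])
    show "M \<le> (\<Sum>i\<in>T. wt (entry best_grid) i)" if "T \<in> set (parts I) - closed_parts best_grid" for T
      using closed_parts_iff[of T best_grid] that by simp
    show "dual_value M (wt (entry best_grid)) (($) c) T (c $ i) \<le> open_value best_grid T"
      if "T \<in> set (parts I) - closed_parts best_grid" "i \<in> T" for T i
      using that by (intro open_value(2)) auto
  qed (use sub pick(1) entry_nonneg M in auto)
  have "(\<Sum>T\<in>closed_parts best_grid. M * C $ pick T)
      + (\<Sum>T\<in>set (parts I) - closed_parts best_grid. open_value best_grid T)
      = (\<Sum>T\<in>set (parts I). part_value best_grid T)"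
    using sub by (simp add: sum.subset_diff[of "closed_parts best_grid" "set (parts I)"] add.commute)
  then have "((\<Sum>j<K. \<Gamma> $ j * entry best_grid j) + (\<Sum>T\<in>closed_parts best_grid. M * C $ pick T)
      + (\<Sum>T\<in>set (parts I) - closed_parts best_grid. open_value best_grid T)) / M \<le> (N * V) / M"
    using best M by (intro divide_right_mono) linarith+
  then show ?thesis using cost by (elim order_trans) simp
qed

end

text \<open>Both 1 and \<open>s\<close> are at most \<open>k * s\<close>, so \<open>s + N\<close> is
  at most \<open>k * s * (y + 4)\<close>. The power is expanded in \<open>y\<close> by the binomial
  theorem, and all coefficients outside the row \<open>i = d\<close> vanish.\<close>

lemma polynomial_time_bound:
  fixes y :: real and c s d k N :: nat
  assumes y: "0 \<le> y" and N: "real N \<le> real k * real s * (y + 2) + 1" and "1 \<le> s" "1 \<le> k"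
  shows "real (c * (s + N) ^ d) \<le>
    (\<Sum>i\<le>d. \<Sum>j\<le>d. (if i = d then c * k ^ d * (d choose j) * 4 ^ (d - j) else 0) * real s ^ i * y ^ j)"
proof -
  have "1 * 1 \<le> real k * real s" using assms(3,4) by (intro mult_mono) auto
  moreover have "1 * real s \<le> real k * real s" using assms(4) by (intro mult_right_mono) auto
  ultimately have "real (s + N) \<le> real k * real s * (y + 4)"
    using N by (simp add: algebra_simps)
  then have "real (s + N) ^ d \<le> (real k * real s * (y + 4)) ^ d" by (intro power_mono) auto
  then have "real c * real (s + N) ^ d \<le> real c * (real k * real s * (y + 4)) ^ d"
    by (intro mult_left_mono) auto
  also have "\<dots> = real c * real k ^ d * real s ^ d * (\<Sum>j\<le>d. real (d choose j) * y ^ j * 4 ^ (d - j))"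
    by (simp add: power_mult_distrib binomial_ring mult.assoc)
  also have "\<dots> = (\<Sum>j\<le>d. real (c * k ^ d * (d choose j) * 4 ^ (d - j)) * real s ^ d * y ^ j)"
    by (simp add: sum_distrib_left mult_ac)
  also have "\<dots> = (\<Sum>i\<in>{d}. \<Sum>j\<le>d. (if i = d then c * k ^ d * (d choose j) * 4 ^ (d - j) else 0) * real s ^ i * y ^ j)"
    by simp
  also have "\<dots> = (\<Sum>i\<le>d. \<Sum>j\<le>d. (if i = d then c * k ^ d * (d choose j) * 4 ^ (d - j) else 0) * real s ^ i * y ^ j)"
    by (intro sum.mono_neutral_left) auto
  finally show ?thesis by simp
qed

theorem theorem18:
  fixes K :: nat
  shows "admits_FPTAS (two_stage_RS_HP1 K)"
proof -
  let ?P = "two_stage_RS_HP1 K"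
  obtain p c d where p: "\<And>x. grid_bound K x \<ge> 0 \<Longrightarrow>
    \<exists>t\<le>c * (esize x + nat (grid_bound K x)) ^ d.
      runs p (encode x) (encode (fptas_code K (x, [0..grid_bound K x]))) t"
    using runs_with_upto[OF ptime_grid_bound ptime_fptas_code] by blast
  show ?thesis
    unfolding admits_FPTAS_def Let_def
  proof (intro exI ballI allI impI)
    fix I :: RS_instance and \<epsilon> :: rat
    assume "I \<in> valid_inputs ?P" and \<epsilon>: "0 < \<epsilon>"
    then have I: "I \<in> RS_instances K" by (simp add: two_stage_RS_HP1_def)
    obtain a b where ab: "quotient_of \<epsilon> = (a, b)" by fastforce
    have \<epsilon>_eq: "real_of_rat \<epsilon> = of_int a / of_int b"
      using quotient_of_div[OF ab] by (simp add: of_rat_divide)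
    have b: "0 < b" using ab by (rule quotient_of_denom_pos)
    have a: "0 < a" using \<epsilon> quotient_of_div[OF ab] b by (simp add: zero_less_divide_iff)
    define x where "x = (code_of I, quotient_of \<epsilon>)"
    define M where "M = scaling K x"
    define N where "N = grid_bound K x"
    let ?n = "dimen I"
    have M_eq: "M = int ?n * (int K + 1) * (b div a + 1) + 1"
      by (simp add: M_def x_def scaling_def code_of_def ab)
    have N_eq: "N = M + int ?n * (int K + 1)"
      by (simp add: N_def M_def grid_bound_def x_def code_of_def)
    have q: "0 \<le> b div a" using a b by (simp add: pos_imp_zdiv_nonneg_iff)
    then have M: "0 < M" unfolding M_eq by (simp add: add_nonneg_pos)
    interpret RS_code K I M N
      using I M by unfold_locales (auto simp: N_eq algebra_simps)
    have encode_x: "encode x = Pair (enc_input ?P I) (enc_rat \<epsilon>)"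
      by (simp add: x_def encode_prod_def[of "(_, quotient_of _)"] encode_code_of encode_quotient_of
          two_stage_RS_HP1_def)
    have "fptas_code K (x, [0..N]) = solve_code K (int n) M (map ints_of (parts I)) C' c' Us' \<Gamma>' [0..N]"
      by (simp add: fptas_code_def x_def code_of_def ab M_def denominator_def Let_def)
    then have result: "encode (fptas_code K (x, [0..N])) = enc_solution ?P solution"
      using solve_code by (simp add: two_stage_RS_HP1_def)
    obtain t where t: "t \<le> c * (esize x + nat N) ^ d"
      "runs p (Pair (enc_input ?P I) (enc_rat \<epsilon>)) (enc_solution ?P solution) t"
      using p[of x] N_nonneg unfolding N_def[symmetric] result encode_x by auto
    have objective: "objective ?P I = cost" and solutions: "solutions ?P I = first_stage n X"
      by (simp_all add: two_stage_RS_HP1_def)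
    \<comment> \<open>The dimension is written in binary, so its own encoding does not bound it; the
      list of \<open>n\<close> first-stage costs does.\<close>
    have "n = length (fractions_of (first_cost I))"
      by (simp add: fractions_of_def dims)
    also have "\<dots> \<le> esize x"
      using length_le_esize[of "fractions_of (first_cost I)"] by (simp add: x_def code_of_def)
    finally have n: "n \<le> esize x" .
    have "b div a = \<lfloor>1 / real_of_rat \<epsilon>\<rfloor>"
      by (simp add: \<epsilon>_eq floor_divide_of_int_eq)
    then have q_le: "real_of_int (b div a) \<le> 1 / of_rat \<epsilon>"
      and q_ge: "1 / of_rat \<epsilon> \<le> real_of_int (b div a) + 1"
      by linarith+
    \<comment> \<open>\<open>N / M\<close> is 1 plus \<open>n * (K + 1) / M\<close>, and
      \<open>M\<close> was chosen to be at least \<open>n * (K + 1)\<close> divided by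
      \<epsilon>.\<close>
    have ratio: "N / M \<le> 1 + of_rat \<epsilon>"
    proof -
      have e: "0 < real_of_rat \<epsilon>" using \<epsilon> by simp
      have "real n * (real K + 1) * (1 / of_rat \<epsilon>) \<le> real n * (real K + 1) * (real_of_int (b div a) + 1)"
        by (intro mult_left_mono q_ge) auto
      also have "\<dots> \<le> M" unfolding M_eq by simp
      finally have "real n * (real K + 1) \<le> M * of_rat \<epsilon>"
        using e by (simp add: field_simps)
      then show ?thesis using M by (simp add: N_eq field_simps)
    qed
    \<comment> \<open>The optimum is an infimum, so the comparison is made with every solution
      \<open>z\<close>. The cost of \<open>z\<close> can be infinite: an open part none of whose
      elements lies in a budget set can be made arbitrarily expensive.\<close>
    have approx: "cost solution \<le> ereal (1 + of_rat \<epsilon>) * cost z" if z: "z \<in> first_stage n X" for z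
    proof (cases "cost z")
      case (real V)
      have "cost solution \<le> ereal (N / M * V)"
        using z real by (intro cost_solution_le) auto
      also have "\<dots> \<le> ereal ((1 + of_rat \<epsilon>) * V)"
        unfolding ereal_less_eq using ratio cost_nonneg[OF z] real by (intro mult_right_mono) auto
      finally show ?thesis by (simp add: real)
    next
      case PInf
      have "0 < 1 + real_of_rat \<epsilon>" using \<epsilon> by (simp add: add_pos_pos)
      then show ?thesis by (simp add: PInf)
    next
      case MInf
      then show ?thesis using cost_nonneg[OF z] by simp
    qed
    have pos: "0 < ereal (1 + real_of_rat \<epsilon>)" using \<epsilon> by (simp add: add_pos_pos)
    have "cost solution / ereal (1 + of_rat \<epsilon>) \<le> optimum ?P I"
      unfolding optimum_def objective solutions
      using pos approx by (intro INF_greatest) (simp add: ereal_divide_le_pos)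
    then have "cost solution \<le> ereal (1 + of_rat \<epsilon>) * optimum ?P I"
      using pos by (simp add: ereal_divide_le_pos)
    moreover
    have "real (nat N) \<le> real (K + 1) * real (esize x) * (1 / of_rat \<epsilon> + 2) + 1"
    proof -
      have "real (nat N) = real (K + 1) * real n * (real_of_int (b div a) + 2) + 1"
        using N_nonneg by (simp add: N_eq M_eq algebra_simps)
      also have "\<dots> \<le> real (K + 1) * real (esize x) * (1 / of_rat \<epsilon> + 2) + 1"
        using n q_le q by (intro add_mono mult_mono order_refl mult_nonneg_nonneg) auto
      finally show ?thesis .
    qed
    then have "real (c * (esize x + nat N) ^ d) \<le> (\<Sum>i\<le>d. \<Sum>j\<le>d.
      (if i = d then c * (K + 1) ^ d * (d choose j) * 4 ^ (d - j) else 0)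
        * real (esize x) ^ i * (1 / of_rat \<epsilon>) ^ j)"
      using \<epsilon> esize_pos[of x] by (intro polynomial_time_bound) auto
    then have "real t \<le> (\<Sum>i\<le>d. \<Sum>j\<le>d.
      (if i = d then c * (K + 1) ^ d * (d choose j) * 4 ^ (d - j) else 0)
        * real (bitsize (Pair (enc_input ?P I) (enc_rat \<epsilon>))) ^ i * (1 / of_rat \<epsilon>) ^ j)"
      unfolding encode_x[symmetric] using t(1) by linarith
    ultimately show "\<exists>x\<in>solutions ?P I. \<exists>t. runs p (Pair (enc_input ?P I) (enc_rat \<epsilon>)) (enc_solution ?P x) t \<and>
        objective ?P I x \<le> ereal (1 + real_of_rat \<epsilon>) * optimum ?P I \<and>
        real t \<le> (\<Sum>i\<le>d. \<Sum>j\<le>d. (if i = d then c * (K + 1) ^ d * (d choose j) * 4 ^ (d - j) else 0)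
          * real (bitsize (Pair (enc_input ?P I) (enc_rat \<epsilon>))) ^ i * (1 / real_of_rat \<epsilon>) ^ j)"
      using t(2) solution_first_stage unfolding objective solutions by blast
  qed
qed

end
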